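(* Let $S$ be a Noetherian domain, and let $\mathfrak{a}_\bullet$ and $\mathfrak{b}_\bullet$ be filtrations of nonzero ideals in $S$. Suppose that $\mathcal{R}^{[k]}(\mathfrak{a}_\bullet)$ and $\mathcal{R}^{[\ell]}(\mathfrak{b}_\bullet)$ are standard graded $S$-algebras for some $k$ and $\ell$ in $\mathbb{N}$, and that $\mathcal{R}(\overline{\mathfrak{b}_\bullet})$ is a finitely generated $\mathcal{R}(\mathfrak{b}_\bullet)$-module. Then $\widehat{\rho}(\mathfrak{a}_\bullet,\mathfrak{b}_\bullet)=\widehat{\rho}(\mathfrak{a}_\bullet,\overline{\mathfrak{b}_\bullet})$ is either infinity or a rational number.
   Context: $\mathbb{N}$ denotes the positive integers. A filtration of ideals in $S$ is a collection $\mathfrak{a}_\bullet=\{\mathfrak{a}_i\}_{i\ge 1}$ of ideals with $\mathfrak{a}_p\mathfrak{a}_q\subseteq\mathfrak{a}_{p+q}$ and $\mathfrak{a}_p\supseteq\mathfrak{a}_{p+1}$ for all $p,q\ge 1$ (convention: $\mathfrak{a}_0=S$). $\overline{\mathfrak{b}_\bullet}=\{\overline{\mathfrak{b}_i}\}_{i\ge1}$ is the family of integral closures. The Rees algebra of such a family is $\mathcal{R}(\mathfrak{a}_\bullet)=\bigoplus_{n\ge0}\mathfrak{a}_nt^n\subseteq S[t]$, and its $k$-th Veronese subalgebra is $\mathcal{R}^{[k]}(\mathfrak{a}_\bullet)=\bigoplus_{n\ge0}\mathfrak{a}_{kn}t^{kn}$; the latter is standard graded if generated over $S$ by $\mathfrak{a}_kt^k$,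 i.e. $\mathfrak{a}_{kn}=\mathfrak{a}_k^n$ for all $n\ge1$. The asymptotic resurgence number is $$\widehat{\rho}(\mathfrak{a}_\bullet,\mathfrak{b}_\bullet)=\sup\left\{\tfrac{s}{r} \mid s,r\in\mathbb{N},\ \mathfrak{a}_{st}\not\subseteq\mathfrak{b}_{rt}\text{ for all sufficiently large } t\right\},$$ with values in the extended reals and $\sup\varnothing=-\infty$.
   Formalization: The formal statement also allows the value −∞ besides infinity or a rational number: if every ideal of the second filtration equals S, the defining set is empty and its supremum is −∞ by convention. *)

theory Defs
  imports
    "HOL-Algebra.Ring_Divisibility"
    "HOL-Algebra.Ideal_Product"
    "HOL-Algebra.Generated_Rings"
    "HOL-Algebra.UnivPoly"
    "HOL-Library.Extended_Real"
begin

text \<open>The convention that the zeroth member of a filtration is the whole ring is part of the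
  definition.\<close>

definition ideal_filtration :: "('a, 'm) ring_scheme \<Rightarrow> (nat \<Rightarrow> 'a set) \<Rightarrow> bool" where
  "ideal_filtration S a \<longleftrightarrow>
     a 0 = carrier S \<and>
     (\<forall>p\<ge>1. ideal (a p) S) \<and>
     (\<forall>p\<ge>1. \<forall>q\<ge>1. a p \<cdot>\<^bsub>S\<^esub> a q \<subseteq> a (p + q)) \<and>
     (\<forall>p\<ge>1. a (p + 1) \<subseteq> a p)"

text \<open>The elements satisfying an equation
  \<open>x ^ n + c 1 * x ^ (n - 1) + \<dots> + c n = 0\<close> with \<open>n \<ge> 1\<close> and \<open>c i\<close> in the \<open>i\<close>-th power of the
  ideal \<open>I\<close>; powers of ideals are taken in the monoid of ideals.\<close>

definition integral_closure :: "('a, 'm) ring_scheme \<Rightarrow> 'a set \<Rightarrow> 'a set" where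
  "integral_closure S I =
     {x \<in> carrier S. \<exists>n::nat. n \<ge> 1 \<and> (\<exists>c.
        (\<forall>i\<in>{1..n}. c i \<in> I [^]\<^bsub>ideals_set S\<^esub> i) \<and>
        x [^]\<^bsub>S\<^esub> n \<oplus>\<^bsub>S\<^esub> (\<Oplus>\<^bsub>S\<^esub>i\<in>{1..n}. c i \<otimes>\<^bsub>S\<^esub> x [^]\<^bsub>S\<^esub> (n - i)) = \<zero>\<^bsub>S\<^esub>)}"

text \<open>Rees algebras and their Veronese subalgebras are given by their carriers, as subsets of the
  univariate polynomial ring over \<open>S\<close>.\<close>

definition rees_algebra :: "('a, 'm) ring_scheme \<Rightarrow> (nat \<Rightarrow> 'a set) \<Rightarrow> (nat \<Rightarrow> 'a) set" where
  "rees_algebra S a = {p \<in> carrier (UP S). \<forall>n. up_ring.coeff (UP S) p n \<in> a n}"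

definition rees_veronese ::
    "('a, 'm) ring_scheme \<Rightarrow> nat \<Rightarrow> (nat \<Rightarrow> 'a set) \<Rightarrow> (nat \<Rightarrow> 'a) set" where
  "rees_veronese S k a =
     {p \<in> rees_algebra S a. \<forall>n. \<not> k dvd n \<longrightarrow> up_ring.coeff (UP S) p n = \<zero>\<^bsub>S\<^esub>}"

text \<open>Generation as an \<open>S\<close>-algebra is generation as a ring once the constant polynomials are
  included.\<close>

definition veronese_standard_graded ::
    "('a, 'm) ring_scheme \<Rightarrow> nat \<Rightarrow> (nat \<Rightarrow> 'a set) \<Rightarrow> bool" where
  "veronese_standard_graded S k a \<longleftrightarrow>
     rees_veronese S k a =
       generate_ring (UP S)
         ({monom (UP S) s 0 | s. s \<in> carrier S} \<union> {monom (UP S) x k | x. x \<in> a k})"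

text \<open>\<open>M\<close> is finitely generated as a module over the subring \<open>A\<close> of \<open>P\<close>, where \<open>M\<close> is an
  \<open>A\<close>-submodule of \<open>P\<close>.\<close>

definition finitely_generated_over :: "('a, 'm) ring_scheme \<Rightarrow> 'a set \<Rightarrow> 'a set \<Rightarrow> bool" where
  "finitely_generated_over P A M \<longleftrightarrow>
     (\<exists>X. finite X \<and> X \<subseteq> M \<and>
        M = {(\<Oplus>\<^bsub>P\<^esub>x\<in>X. c x \<otimes>\<^bsub>P\<^esub> x) | c. c \<in> X \<rightarrow> A})"

text \<open>The supremum in the extended reals gives \<open>Sup {} = -\<infinity>\<close>; this value is attained,
  e.g. if every \<open>b i\<close> is the whole ring.\<close>

definition asymptotic_resurgence :: "(nat \<Rightarrow> 'a set) \<Rightarrow> (nat \<Rightarrow> 'a set) \<Rightarrow> ereal" where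
  "asymptotic_resurgence a b =
     Sup {ereal (real s / real r) | s r. s \<ge> 1 \<and> r \<ge> 1 \<and>
            (\<forall>\<^sub>F t in sequentially. \<not> a (s * t) \<subseteq> b (r * t))}"

end

theory Submission
  imports Defs
begin

text \<open>
  Put \<open>I = a k\<close> and \<open>J = b l\<close>, so that \<open>a (k n) = I ^ n\<close> and \<open>b (l n) = J ^ n\<close>.  Finite generation
  over the Rees algebra of \<open>b\<close> yields a constant \<open>D\<close> with \<open>integral_closure (b n) \<subseteq> b (n - D)\<close>; such
  a bounded shift does not change the supremum, which gives the equality of the two resurgence
  numbers.

  For rationality let \<open>v n\<close> be the largest \<open>r\<close> with \<open>I ^ n\<close> inside the integral closure of \<open>J ^ r\<close>.
  It is finite by Krull's intersection theorem (unless \<open>J\<close> is the whole ring) and superadditive,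
  and the resurgence number is \<open>k / l\<close> divided by the supremum of \<open>v n / n\<close>.  Rees valuations are not
  needed to see that this supremum is attained.  If \<open>v (n + j) > v n + v j\<close> held for all
  \<open>j \<ge> 1\<close>, then \<open>y \<in> I ^ n\<close> would satisfy \<open>y ^ m \<in> integral_closure (J ^ (m (v n + 1) - 1))\<close> for all
  \<open>m \<ge> 1\<close>, so \<open>y\<close> would be almost integral, hence integral, over \<open>J ^ (v n + 1)\<close>, contradicting the
  choice of \<open>v n\<close>.  As the Rees algebra of \<open>J\<close> is Noetherian, finitely many \<open>j\<close>, independent of \<open>n\<close>,
  suffice as witnesses of \<open>v (n + j) = v n + v j\<close>.  Adding such \<open>j\<close> repeatedly shows that
  the largest \<open>v j / j\<close> among them is the supremum.
\<close>

section \<open>Homogeneous ideals of graded rings\<close>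

text \<open>The graded ring is handled through its components inside \<open>R\<close>, so no
  polynomial ring is needed here. Closure under negation is automatic, because degree zero is the
  whole ring and contains \<open>-1\<close>.\<close>

definition graded_family :: "('a, 'm) ring_scheme \<Rightarrow> (nat \<Rightarrow> 'a set) \<Rightarrow> bool" where
  "graded_family R A \<longleftrightarrow>
     A 0 = carrier R \<and> (\<forall>n. A n \<subseteq> carrier R) \<and> (\<forall>n. \<zero>\<^bsub>R\<^esub> \<in> A n) \<and>
     (\<forall>n. \<forall>x\<in>A n. \<forall>y\<in>A n. x \<oplus>\<^bsub>R\<^esub> y \<in> A n) \<and>
     (\<forall>m n. \<forall>x\<in>A m. \<forall>y\<in>A n. x \<otimes>\<^bsub>R\<^esub> y \<in> A (m + n))"

text \<open>A pair \<open>(n, x)\<close> stands for the homogeneous element \<open>x t ^ n\<close> of \<open>\<Oplus>n. A n t ^ n\<close>.\<close>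

definition homogeneous :: "(nat \<Rightarrow> 'a set) \<Rightarrow> (nat \<times> 'a) set" where
  "homogeneous A = {(n, x). x \<in> A n}"

text \<open>These are the homogeneous elements of the ideal generated by \<open>T\<close> in the
  graded ring; sums are only formed within one degree.\<close>

inductive_set hspan ::
    "('a, 'm) ring_scheme \<Rightarrow> (nat \<Rightarrow> 'a set) \<Rightarrow> (nat \<times> 'a) set \<Rightarrow> (nat \<times> 'a) set"
  for R and A and T where
  zero: "(n, \<zero>\<^bsub>R\<^esub>) \<in> hspan R A T"
| gen: "(d, x) \<in> T \<Longrightarrow> r \<in> A m \<Longrightarrow> (m + d, r \<otimes>\<^bsub>R\<^esub> x) \<in> hspan R A T"
| add: "(n, x) \<in> hspan R A T \<Longrightarrow> (n, y) \<in> hspan R A T \<Longrightarrow> (n, x \<oplus>\<^bsub>R\<^esub> y) \<in> hspan R A T"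

text \<open>Noetherianity for homogeneous ideals only, in the form that every homogeneous generating
  set contains a finite one.\<close>

definition graded_noetherian :: "('a, 'm) ring_scheme \<Rightarrow> (nat \<Rightarrow> 'a set) \<Rightarrow> bool" where
  "graded_noetherian R A \<longleftrightarrow>
     (\<forall>T \<subseteq> homogeneous A. \<exists>F \<subseteq> T. finite F \<and> T \<subseteq> hspan R A F)"

lemma hspan_mono:
  assumes "T \<subseteq> U" shows "hspan R A T \<subseteq> hspan R A U"
proof (rule subrelI)
  fix n x assume "(n, x) \<in> hspan R A T"
  then show "(n, x) \<in> hspan R A U"
    by induction (use assms in \<open>auto intro: hspan.intros\<close>)
qed

lemma hspan_finite_support:
  assumes "(n, x) \<in> hspan R A T"
  shows "\<exists>F \<subseteq> T. finite F \<and> (n, x) \<in> hspan R A F"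
  using assms
proof induction
  case (zero n)
  then show ?case by (auto intro: hspan.zero)
next
  case (gen d x r m)
  then show ?case by (intro exI[of _ "{(d, x)}"]) (auto intro: hspan.gen)
next
  case (add n x y)
  then obtain F G where "F \<subseteq> T" "finite F" "(n, x) \<in> hspan R A F"
    "G \<subseteq> T" "finite G" "(n, y) \<in> hspan R A G" by blast
  then show ?case
    using hspan_mono[of F "F \<union> G" R A] hspan_mono[of G "F \<union> G" R A]
    by (intro exI[of _ "F \<union> G"]) (auto intro!: hspan.add)
qed

lemma hspan_finite_support_set:
  assumes "finite B" "B \<subseteq> hspan R A T"
  shows "\<exists>F \<subseteq> T. finite F \<and> B \<subseteq> hspan R A F"
  using assms
proof (induction B)
  case (insert p B)
  then obtain F where F: "F \<subseteq> T" "finite F" "B \<subseteq> hspan R A F" by auto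
  obtain G where G: "G \<subseteq> T" "finite G" "p \<in> hspan R A G"
    using hspan_finite_support[of "fst p" "snd p" R A T] insert.prems by auto
  show ?case
    using F G hspan_mono[of F "F \<union> G" R A] hspan_mono[of G "F \<union> G" R A]
    by (intro exI[of _ "F \<union> G"]) blast
qed auto

context cring
begin

lemma graded_familyD:
  assumes "graded_family R A"
  shows "A 0 = carrier R" "x \<in> A n \<Longrightarrow> x \<in> carrier R" "\<zero> \<in> A n"
    "x \<in> A n \<Longrightarrow> y \<in> A n \<Longrightarrow> x \<oplus> y \<in> A n"
    "x \<in> A m \<Longrightarrow> y \<in> A n \<Longrightarrow> x \<otimes> y \<in> A (m + n)"
    "x \<in> A n \<Longrightarrow> \<ominus> x \<in> A n" "x \<in> carrier R \<Longrightarrow> y \<in> A n \<Longrightarrow> x \<otimes> y \<in> A n"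
proof -
  show mult: "x \<in> A m \<Longrightarrow> y \<in> A n \<Longrightarrow> x \<otimes> y \<in> A (m + n)" for m n x y
    using assms unfolding graded_family_def by blast
  show c: "x \<in> A n \<Longrightarrow> x \<in> carrier R" for n x using assms unfolding graded_family_def by blast
  show smult: "x \<in> carrier R \<Longrightarrow> y \<in> A n \<Longrightarrow> x \<otimes> y \<in> A n" for n x y
    using mult[of x 0 y n] assms unfolding graded_family_def by simp
  show "x \<in> A n \<Longrightarrow> \<ominus> x \<in> A n"
    using smult[of "\<ominus> \<one>" x n] c[of x n] by (simp add: l_minus)
qed (use assms in \<open>auto simp: graded_family_def\<close>)

lemma hspan_homogeneous:
  assumes "graded_family R A" "T \<subseteq> homogeneous A"
  shows "hspan R A T \<subseteq> homogeneous A"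
proof (rule subrelI)
  fix n x assume "(n, x) \<in> hspan R A T"
  then show "(n, x) \<in> homogeneous A"
  proof induction
    case (gen d x r m)
    then have "x \<in> A d" using assms(2) by (auto simp: homogeneous_def)
    then show ?case using gen graded_familyD(5)[OF assms(1)] by (simp add: homogeneous_def)
  qed (use graded_familyD[OF assms(1)] in \<open>auto simp: homogeneous_def\<close>)
qed

lemma hspan_mult:
  assumes A: "graded_family R A" and T: "T \<subseteq> homogeneous A"
    and "(n, x) \<in> hspan R A T" "s \<in> A k"
  shows "(k + n, s \<otimes> x) \<in> hspan R A T"
  using assms(3,4)
proof induction
  case (zero n)
  then show ?case using graded_familyD(2)[OF A] by (auto intro: hspan.zero)
next
  case (gen d x r m)
  have c: "x \<in> carrier R" using gen T graded_familyD(2)[OF A] by (auto simp: homogeneous_def)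
  have "(k + m + d, (s \<otimes> r) \<otimes> x) \<in> hspan R A T"
    using gen graded_familyD(5)[OF A] by (intro hspan.gen) auto
  then show ?case using c gen graded_familyD(2)[OF A] by (simp add: m_assoc ac_simps)
next
  case (add n x y)
  have "x \<in> carrier R" "y \<in> carrier R"
    using add hspan_homogeneous[OF A T] graded_familyD(2)[OF A] by (auto simp: homogeneous_def)
  then show ?case using add graded_familyD(2)[OF A] by (simp add: r_distr hspan.add)
qed

lemma hspan_least:
  assumes A: "graded_family R A" and U: "U \<subseteq> homogeneous A" and "T \<subseteq> hspan R A U"
  shows "hspan R A T \<subseteq> hspan R A U"
proof (rule subrelI)
  fix n x assume "(n, x) \<in> hspan R A T"
  then show "(n, x) \<in> hspan R A U"
    by induction
      (use assms(3) in \<open>auto intro: hspan.zero hspan.add hspan_mult[OF A U]\<close>)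
qed

lemma hspan_superset:
  assumes A: "graded_family R A" and T: "T \<subseteq> homogeneous A"
  shows "T \<subseteq> hspan R A T"
proof
  fix p assume p: "p \<in> T"
  obtain d x where "p = (d, x)" by fastforce
  moreover have "x \<in> carrier R"
    using calculation p T graded_familyD(2)[OF A] by (auto simp: homogeneous_def)
  ultimately show "p \<in> hspan R A T"
    using hspan.gen[of d x T \<one> A 0 R] p graded_familyD(1)[OF A] by simp
qed

text \<open>\<open>lower A y e n\<close> collects the elements of degree \<open>n\<close> that can be written with
  \<open>y\<close>-degree less than \<open>e\<close>.\<close>

primrec lower :: "(nat \<Rightarrow> 'a set) \<Rightarrow> 'a \<Rightarrow> nat \<Rightarrow> nat \<Rightarrow> 'a set" where
  "lower A y 0 n = {\<zero>}"
| "lower A y (Suc e) n =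
     lower A y e n \<union> {x \<oplus> y [^] e \<otimes> f | x f. x \<in> lower A y e n \<and> e \<le> n \<and> f \<in> A (n - e)}"

text \<open>With \<open>y\<close> placed in degree one, this is the component of degree
  \<open>n\<close> of the graded ring \<open>A[y t]\<close>.\<close>

definition adjoin :: "(nat \<Rightarrow> 'a set) \<Rightarrow> 'a \<Rightarrow> nat \<Rightarrow> 'a set" where
  "adjoin A y n = (\<Union>e. lower A y e n)"

lemma lower_mono: "e \<le> e' \<Longrightarrow> lower A y e n \<subseteq> lower A y e' n"
  by (rule lift_Suc_mono_le) auto

section \<open>Closure properties of \<open>A[y t]\<close> and Hilbert's basis theorem\<close>

context
  fixes A y
  assumes A: "graded_family R A" and y: "y \<in> carrier R"
begin

lemma lower_carrier: "x \<in> lower A y e n \<Longrightarrow> x \<in> carrier R"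
  by (induction e arbitrary: x) (use graded_familyD(2)[OF A] y in auto)

lemma lower_zero: "\<zero> \<in> lower A y e n"
  by (induction e) auto

lemma lower_add: "x \<in> lower A y e n \<Longrightarrow> x' \<in> lower A y e n \<Longrightarrow> x \<oplus> x' \<in> lower A y e n"
proof (induction e arbitrary: x x')
  case (Suc e)
  \<comment> \<open>A zero coefficient \<open>f\<close> puts elements without a term in
    \<open>y ^ e\<close> into the same shape. When \<open>e > n\<close> the difference
    \<open>n - e\<close> is truncated, and zero is the only coefficient allowed.\<close>
  have dec: "\<exists>z f. x = z \<oplus> y [^] e \<otimes> f \<and> z \<in> lower A y e n \<and> f \<in> A (n - e) \<and> (e \<le> n \<or> f = \<zero>)"
    if "x \<in> lower A y (Suc e) n" for x
  proof (cases "x \<in> lower A y e n")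
    case True
    then show ?thesis using lower_carrier[OF True] y graded_familyD(3)[OF A]
      by (intro exI[of _ x] exI[of _ \<zero>]) auto
  qed (use that in auto)
  obtain z f where z: "x = z \<oplus> y [^] e \<otimes> f" "z \<in> lower A y e n" "f \<in> A (n - e)" "e \<le> n \<or> f = \<zero>"
    using dec[OF Suc.prems(1)] by blast
  obtain z' f' where z': "x' = z' \<oplus> y [^] e \<otimes> f'" "z' \<in> lower A y e n" "f' \<in> A (n - e)"
      "e \<le> n \<or> f' = \<zero>"
    using dec[OF Suc.prems(2)] by blast
  have c: "z \<in> carrier R" "z' \<in> carrier R" "f \<in> carrier R" "f' \<in> carrier R" "y [^] e \<in> carrier R"
    using z z' lower_carrier graded_familyD(2)[OF A] y by auto
  have eq: "x \<oplus> x' = (z \<oplus> z') \<oplus> y [^] e \<otimes> (f \<oplus> f')"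
    using c unfolding z(1) z'(1) by (simp add: r_distr a_ac)
  show ?case
  proof (cases "e \<le> n")
    case True
    then show ?thesis
      using Suc.IH[OF z(2) z'(2)] graded_familyD(4)[OF A z(3) z'(3)] unfolding eq by auto
  next
    case False
    then have "f = \<zero>" "f' = \<zero>" using z z' by auto
    then show ?thesis using Suc.IH[OF z(2) z'(2)] c unfolding eq by simp
  qed
qed auto

lemma lower_smult: "x \<in> lower A y e n \<Longrightarrow> r \<in> A m \<Longrightarrow> r \<otimes> x \<in> lower A y e (m + n)"
proof (induction e arbitrary: x)
  case 0
  then show ?case using graded_familyD(2)[OF A] by auto
next
  case (Suc e)
  show ?case
  proof (cases "x \<in> lower A y e n")
    case True
    then show ?thesis using Suc by auto
  next
    case False
    then obtain z f where z: "x = z \<oplus> y [^] e \<otimes> f" "z \<in> lower A y e n" "e \<le> n" "f \<in> A (n - e)"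
      using Suc.prems by auto
    have c: "z \<in> carrier R" "f \<in> carrier R" "y [^] e \<in> carrier R" "r \<in> carrier R"
      using z lower_carrier graded_familyD(2)[OF A] y Suc.prems by auto
    have "r \<otimes> x = r \<otimes> z \<oplus> y [^] e \<otimes> (r \<otimes> f)"
      unfolding z(1) using c by (simp add: r_distr m_ac)
    moreover have "r \<otimes> f \<in> A (m + n - e)"
      using graded_familyD(5)[OF A Suc.prems(2) z(4)] z(3) by simp
    ultimately show ?thesis using Suc.IH[OF z(2) Suc.prems(2)] z(3) by auto
  qed
qed

lemma lower_mult_gen: "x \<in> lower A y e n \<Longrightarrow> y \<otimes> x \<in> lower A y (Suc e) (Suc n)"
proof (induction e arbitrary: x)
  case 0
  then show ?case using y by simp
next
  case (Suc e)
  show ?case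
  proof (cases "x \<in> lower A y e n")
    case True
    then show ?thesis using Suc.IH lower_mono[of "Suc e" "Suc (Suc e)" A y "Suc n"] by auto
  next
    case False
    then obtain z f where z: "x = z \<oplus> y [^] e \<otimes> f" "z \<in> lower A y e n" "e \<le> n" "f \<in> A (n - e)"
      using Suc.prems by auto
    have c: "z \<in> carrier R" "f \<in> carrier R" "y [^] e \<in> carrier R"
      using z lower_carrier graded_familyD(2)[OF A] y by auto
    have "y \<otimes> x = y \<otimes> z \<oplus> y [^] Suc e \<otimes> f"
      unfolding z(1) using c y by (simp add: r_distr m_ac)
    moreover have "y \<otimes> z \<in> lower A y (Suc e) (Suc n)" "Suc e \<le> Suc n" "f \<in> A (Suc n - Suc e)"
      using Suc.IH[OF z(2)] z(3,4) by simp_all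
    ultimately show ?thesis unfolding lower.simps(2)[of A y "Suc e"] by blast
  qed
qed

lemma lower_mult_gen_pow: "x \<in> lower A y e n \<Longrightarrow> y [^] i \<otimes> x \<in> lower A y (i + e) (i + n)"
proof (induction i)
  case 0
  then show ?case using lower_carrier by simp
next
  case (Suc i)
  have "y [^] Suc i \<otimes> x = y \<otimes> (y [^] i \<otimes> x)"
    using y lower_carrier[OF Suc.prems] by (simp add: m_ac)
  then show ?case using lower_mult_gen[OF Suc.IH[OF Suc.prems]] by (simp del: lower.simps)
qed

lemma lower_uminus: "x \<in> lower A y e n \<Longrightarrow> \<ominus> x \<in> lower A y e n"
  using lower_smult[of x e n "\<ominus> \<one>" 0] graded_familyD(1)[OF A] lower_carrier[of x e n]
  by (simp add: l_minus)

lemma gen_pow_adjoin: "f \<in> A n \<Longrightarrow> y [^] i \<otimes> f \<in> adjoin A y (i + n)"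
proof -
  assume f: "f \<in> A n"
  have "f = \<zero> \<oplus> y [^] (0::nat) \<otimes> f" using graded_familyD(2)[OF A f] by simp
  then have "f \<in> lower A y (Suc 0) n" using f by (simp) (metis nat_pow_0)
  from lower_mult_gen_pow[OF this, of i] show ?thesis unfolding adjoin_def by blast
qed

lemma graded_family_adjoin: "graded_family R (adjoin A y)"
  unfolding graded_family_def
proof (intro conjI allI ballI)
  show carr: "adjoin A y n \<subseteq> carrier R" for n
    using lower_carrier unfolding adjoin_def by blast
  show zero: "\<zero> \<in> adjoin A y n" for n
    using lower_zero unfolding adjoin_def by blast
  have base: "x \<in> adjoin A y n" if "x \<in> A n" for x n
    using gen_pow_adjoin[OF that, of 0] graded_familyD(2)[OF A that] by simp
  then show "adjoin A y 0 = carrier R"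
    using carr graded_familyD(1)[OF A] by blast
  show add: "x \<oplus> x' \<in> adjoin A y n" if xx': "x \<in> adjoin A y n" "x' \<in> adjoin A y n" for x x' n
  proof -
    obtain e e' where "x \<in> lower A y e n" "x' \<in> lower A y e' n"
      using xx' unfolding adjoin_def by blast
    then have "x \<in> lower A y (max e e') n" "x' \<in> lower A y (max e e') n"
      using lower_mono[of e "max e e'" A y n] lower_mono[of e' "max e e'" A y n] by auto
    then show ?thesis using lower_add unfolding adjoin_def by blast
  qed
  fix m n x x' assume x': "x' \<in> adjoin A y n"
  then obtain e' where e': "x' \<in> lower A y e' n" unfolding adjoin_def by blast
  have xc: "x' \<in> carrier R" using lower_carrier[OF e'] .
  \<comment> \<open>Induction on the \<open>y\<close>-degree of the left factor, splitting off its
    top term \<open>y ^ e * f\<close>.\<close>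
  have "x \<otimes> x' \<in> adjoin A y (m + n)" if "x \<in> lower A y e m" for e x
    using that
  proof (induction e arbitrary: x)
    case 0
    then show ?case using zero xc by simp
  next
    case (Suc e)
    show ?case
    proof (cases "x \<in> lower A y e m")
      case False
      then obtain z f where z: "x = z \<oplus> y [^] e \<otimes> f" "z \<in> lower A y e m" "e \<le> m" "f \<in> A (m - e)"
        using Suc.prems by auto
      have c: "z \<in> carrier R" "f \<in> carrier R" "y [^] e \<in> carrier R" "x' \<in> carrier R"
        using z lower_carrier graded_familyD(2)[OF A] y xc by auto
      have eq: "x \<otimes> x' = z \<otimes> x' \<oplus> y [^] e \<otimes> (f \<otimes> x')"
        unfolding z(1) using c by (simp add: l_distr r_distr m_ac)
      have "y [^] e \<otimes> (f \<otimes> x') \<in> lower A y (e + e') (e + (m - e + n))"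
        by (intro lower_mult_gen_pow lower_smult e' z)
      then have "y [^] e \<otimes> (f \<otimes> x') \<in> adjoin A y (m + n)"
        using z(3) unfolding adjoin_def by auto
      then show ?thesis unfolding eq using Suc.IH[OF z(2)] add by blast
    qed (use Suc in auto)
  qed
  then show "x \<otimes> x' \<in> adjoin A y (m + n)" if "x \<in> adjoin A y m"
    using that unfolding adjoin_def by blast
qed

text \<open>Hilbert's basis theorem: among the elements not yet generated, take one of least
  \<open>y\<close>-degree; if its leading coefficient is generated by the previous leading coefficients, then
  subtracting the corresponding combination lowers the \<open>y\<close>-degree.\<close>

lemma graded_noetherian_adjoin:
  assumes N: "graded_noetherian R A"
  shows "graded_noetherian R (adjoin A y)"
  unfolding graded_noetherian_def
proof (intro allI impI)
  fix T assume T: "T \<subseteq> homogeneous (adjoin A y)"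
  define B where "B = adjoin A y"
  have B: "graded_family R B" and TB: "T \<subseteq> homogeneous B"
    using graded_family_adjoin T by (simp_all add: B_def)
  define H where "H = hspan R B T"
  have HB: "H \<subseteq> homogeneous B" unfolding H_def by (rule hspan_homogeneous[OF B TB])
  \<comment> \<open>Generators may first be sought in the whole homogeneous ideal \<open>H\<close>:
    each of them involves only finitely many members of \<open>T\<close>, which are extracted at the
    end.\<close>
  have "\<exists>F0 \<subseteq> H. finite F0 \<and> H \<subseteq> hspan R B F0"
  proof (rule ccontr)
    assume neg: "\<not> ?thesis"
    define ydeg where "ydeg p = (LEAST e. snd p \<in> lower A y e (fst p))" for p
    define P where "P g i p \<longleftrightarrow> p \<in> H \<and> p \<notin> hspan R B (g ` {..<i}) \<and>
      (\<forall>q \<in> H. q \<notin> hspan R B (g ` {..<i}) \<longrightarrow> ydeg p \<le> ydeg q)"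
      for g and i :: nat and p
    \<comment> \<open>Greedy choice: \<open>g i\<close> has least \<open>y\<close>-degree among the
      elements of \<open>H\<close> outside the span of the earlier choices.\<close>
    have "\<exists>g. \<forall>i. P g i (g i)"
    proof (rule dependent_wellorder_choice)
      fix r and f g :: "nat \<Rightarrow> nat \<times> 'a" and i :: nat
      assume "\<And>j. j < i \<Longrightarrow> f j = g j"
      then have "f ` {..<i} = g ` {..<i}" by (auto intro: image_cong)
      then show "P f i r = P g i r" unfolding P_def by simp
    next
      fix i :: nat and f
      assume "\<And>j. j < i \<Longrightarrow> P f j (f j)"
      then have "f ` {..<i} \<subseteq> H" unfolding P_def by auto
      then obtain p where p: "p \<in> H" "p \<notin> hspan R B (f ` {..<i})"
        using neg by (meson finite_imageI finite_lessThan subsetI)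
      show "\<exists>p. P f i p"
        using ex_has_least_nat[of "\<lambda>p. p \<in> H \<and> p \<notin> hspan R B (f ` {..<i})" p ydeg] p
        unfolding P_def by blast
    qed
    then obtain g where g: "P g i (g i)" for i by blast
    then have gH: "g i \<in> H" and gnot: "g i \<notin> hspan R B (g ` {..<i})"
      and gmin: "q \<in> H \<Longrightarrow> q \<notin> hspan R B (g ` {..<i}) \<Longrightarrow> ydeg (g i) \<le> ydeg q" for i q
      unfolding P_def by blast+
    define d h where "d i = fst (g i)" and "h i = snd (g i)" for i
    have g_eq: "g i = (d i, h i)" for i unfolding d_def h_def by simp
    have gB: "g ` I \<subseteq> homogeneous B" for I using gH HB by blast
    \<comment> \<open>Each \<open>h i\<close> has a leading term \<open>y ^ e * a\<close>:
      \<open>y\<close>-degree zero would mean \<open>h i = 0\<close>, and zero lies in every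
      span.\<close>
    have "\<exists>e x a. ydeg (g i) = Suc e \<and> h i = x \<oplus> y [^] e \<otimes> a \<and> x \<in> lower A y e (d i) \<and>
        e \<le> d i \<and> a \<in> A (d i - e)" for i
    proof -
      have "h i \<in> B (d i)" using gB[of "{i}"] by (simp add: g_eq homogeneous_def)
      then have "\<exists>e. h i \<in> lower A y e (d i)" unfolding B_def adjoin_def by blast
      then have low: "h i \<in> lower A y (ydeg (g i)) (d i)"
        unfolding ydeg_def d_def h_def by (rule LeastI_ex)
      have "ydeg (g i) \<noteq> 0"
      proof
        assume "ydeg (g i) = 0"
        then have "h i = \<zero>" using low by simp
        then have "g i \<in> hspan R B (g ` {..<i})" unfolding g_eq[of i] by (simp only: hspan.zero)
        then show False using gnot by blast
      qed
      then obtain e where e: "ydeg (g i) = Suc e" using not0_implies_Suc by blast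
      have "h i \<notin> lower A y e (d i)"
      proof
        assume "h i \<in> lower A y e (d i)"
        then have "ydeg (g i) \<le> e" unfolding ydeg_def d_def h_def by (rule Least_le)
        then show False using e by simp
      qed
      then show ?thesis using low e by auto
    qed
    then obtain e x a where e: "\<And>i. ydeg (g i) = Suc (e i)"
      and h: "\<And>i. h i = x i \<oplus> y [^] e i \<otimes> a i" and x: "\<And>i. x i \<in> lower A y (e i) (d i)"
      and ed: "\<And>i. e i \<le> d i" and a: "\<And>i. a i \<in> A (d i - e i)"
      by metis
    \<comment> \<open>The spans grow with the index, so the minimum is taken over ever smaller
      sets.\<close>
    have e_mono: "e j \<le> e i" if "j \<le> i" for i j
    proof -
      have "hspan R B (g ` {..<j}) \<subseteq> hspan R B (g ` {..<i})"
        by (rule hspan_mono) (use that in auto)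
      then have "ydeg (g j) \<le> ydeg (g i)" using gmin gH gnot by blast
      then show ?thesis using e by simp
    qed
    \<comment> \<open>The leading coefficients, as homogeneous elements of \<open>A\<close>;
      noetherianity of \<open>A\<close> makes finitely many of them generate all.\<close>
    define u where "u i = (d i - e i, a i)" for i
    have "range u \<subseteq> homogeneous A" using a unfolding u_def homogeneous_def by auto
    then obtain F where F: "F \<subseteq> range u" "finite F" "range u \<subseteq> hspan R A F"
      using N[unfolded graded_noetherian_def, rule_format, of "range u"] by metis
    obtain I where I: "finite I" "F = u ` I" using F finite_subset_image by metis
    obtain M where M: "I \<subseteq> {..<M}" using finite_nat_iff_bounded I(1) by blast
    \<comment> \<open>A combination \<open>f\<close> of leading coefficients is the coefficient of
      \<open>y ^ e M\<close> in a combination of the \<open>g j\<close> with \<open>j < M\<close>,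
      up to lower terms \<open>z\<close>. The missing factor \<open>y ^ (e M - e j)\<close> exists
      because \<open>e\<close> is monotone.\<close>
    have lift: "\<exists>z \<in> lower A y (e M) (m + e M).
        (m + e M, y [^] e M \<otimes> f \<oplus> z) \<in> hspan R B (g ` {..<M})"
      if "(m, f) \<in> hspan R A (u ` {..<M})" for m f
      using that
    proof induction
      case (zero n)
      then show ?case using y lower_zero by (intro bexI[of _ \<zero>]) (auto intro: hspan.zero)
    next
      case (gen k f r m)
      then obtain j where j: "j < M" "k = d j - e j" "f = a j" by (auto simp: u_def)
      define r' where "r' = y [^] (e M - e j) \<otimes> r"
      have "r' \<in> B (e M - e j + m)" unfolding r'_def B_def by (rule gen_pow_adjoin[OF gen(2)])
      then have in_span: "(e M - e j + m + d j, r' \<otimes> h j) \<in> hspan R B (g ` {..<M})"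
        using j by (intro hspan.gen) (auto simp flip: g_eq)
      have deg: "e M - e j + m + d j = m + k + e M" using e_mono[of j M] ed[of j] j by simp
      have c: "x j \<in> carrier R" "a j \<in> carrier R" "r \<in> carrier R"
        using lower_carrier[OF x] graded_familyD(2)[OF A] a gen(2) by auto
      have "y [^] (e M - e j) \<otimes> (r \<otimes> x j) \<in> lower A y (e M - e j + e j) (e M - e j + (m + d j))"
        by (intro lower_mult_gen_pow lower_smult x gen)
      then have z: "r' \<otimes> x j \<in> lower A y (e M) (m + k + e M)"
        using deg e_mono[of j M] j c y by (simp add: r'_def m_assoc add.assoc)
      have "y [^] e M = y [^] (e M - e j) \<otimes> y [^] e j"
        using e_mono[of j M] j y by (simp add: nat_pow_mult)
      then have "r' \<otimes> h j = y [^] e M \<otimes> (r \<otimes> f) \<oplus> r' \<otimes> x j"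
        unfolding r'_def h j(3) using c y by (simp add: r_distr m_ac a_ac)
      then show ?case using in_span z unfolding deg by auto
    next
      case (add n f f')
      obtain z z' where z: "z \<in> lower A y (e M) (n + e M)" "z' \<in> lower A y (e M) (n + e M)"
        "(n + e M, y [^] e M \<otimes> f \<oplus> z) \<in> hspan R B (g ` {..<M})"
        "(n + e M, y [^] e M \<otimes> f' \<oplus> z') \<in> hspan R B (g ` {..<M})"
        using add.IH by blast
      have "u ` {..<M} \<subseteq> homogeneous A" using a unfolding u_def homogeneous_def by auto
      from hspan_homogeneous[OF A this] add.hyps
      have c: "f \<in> carrier R" "f' \<in> carrier R"
        using graded_familyD(2)[OF A] by (auto simp: homogeneous_def)
      have "(y [^] e M \<otimes> f \<oplus> z) \<oplus> (y [^] e M \<otimes> f' \<oplus> z') =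
          y [^] e M \<otimes> (f \<oplus> f') \<oplus> (z \<oplus> z')"
        using c y lower_carrier[OF z(1)] lower_carrier[OF z(2)] by (simp add: r_distr a_ac)
      then show ?case using hspan.add[OF z(3,4)] lower_add[OF z(1,2)] by auto
    qed
    have "(d M - e M, a M) \<in> hspan R A (u ` {..<M})"
      using F(3) hspan_mono[of F "u ` {..<M}" R A] M I(2) unfolding u_def by blast
    from lift[OF this] obtain z where
      z: "z \<in> lower A y (e M) (d M)" "(d M, y [^] e M \<otimes> a M \<oplus> z) \<in> hspan R B (g ` {..<M})"
      using ed[of M] by auto
    define w where "w = y [^] e M \<otimes> a M \<oplus> z"
    have c: "x M \<in> carrier R" "a M \<in> carrier R" "z \<in> carrier R" "w \<in> carrier R"
      using lower_carrier[OF x] lower_carrier[OF z(1)] graded_familyD(2)[OF A a] y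
      by (auto simp: w_def)
    \<comment> \<open>The leading terms cancel, so \<open>h M - w\<close> has
      \<open>y\<close>-degree at most \<open>e M\<close>. It is still outside the span, contrary to
      the minimality of \<open>g M\<close>, whose \<open>y\<close>-degree is
      \<open>e M + 1\<close>.\<close>
    have q_eq: "h M \<ominus> w = x M \<ominus> z"
      unfolding h w_def using c y by (simp add: a_minus_def minus_add a_ac r_neg r_neg1 r_neg2)
    have q_low: "h M \<ominus> w \<in> lower A y (e M) (d M)"
      unfolding q_eq unfolding a_minus_def by (intro lower_add x lower_uminus z)
    have "hspan R B (g ` {..<M}) \<subseteq> H"
      unfolding H_def by (rule hspan_least[OF B TB]) (use gH in \<open>auto simp: H_def\<close>)
    then have "(d M, \<ominus> \<one> \<otimes> w) \<in> H"
      using hspan_mult[OF B TB, of "d M" w "\<ominus> \<one>" 0] z(2) graded_familyD(1)[OF B]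
      unfolding H_def w_def by auto
    then have qH: "(d M, h M \<ominus> w) \<in> H"
      using hspan.add[of "d M" "h M" R B T "\<ominus> w"] gH[of M] c
      unfolding H_def g_eq a_minus_def by (simp add: l_minus)
    have hc: "h M \<in> carrier R" unfolding h using c y by simp
    have "(d M, h M \<ominus> w) \<notin> hspan R B (g ` {..<M})"
    proof
      assume "(d M, h M \<ominus> w) \<in> hspan R B (g ` {..<M})"
      from hspan.add[OF this z(2)] have "g M \<in> hspan R B (g ` {..<M})"
        using c hc unfolding g_eq w_def[symmetric] by (simp add: a_minus_def a_assoc l_neg)
      then show False using gnot by blast
    qed
    then have "ydeg (g M) \<le> ydeg (d M, h M \<ominus> w)" using gmin qH by blast
    also have "\<dots> \<le> e M" unfolding ydeg_def by (rule Least_le) (use q_low in simp)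
    finally show False using e[of M] by simp
  qed
  then obtain F0 where F0: "F0 \<subseteq> H" "finite F0" "H \<subseteq> hspan R B F0" by blast
  obtain F where F: "F \<subseteq> T" "finite F" "F0 \<subseteq> hspan R B F"
    using hspan_finite_support_set F0(1,2) unfolding H_def by meson
  have "T \<subseteq> hspan R B F"
    using hspan_superset[OF B TB] F0(3) hspan_least[OF B _ F(3)] F(1) TB unfolding H_def by blast
  then show "\<exists>F \<subseteq> T. finite F \<and> T \<subseteq> hspan R (adjoin A y) F"
    using F unfolding B_def by blast
qed

end

definition trivial_grading :: "nat \<Rightarrow> 'a set" where
  "trivial_grading n = (if n = 0 then carrier R else {\<zero>})"

lemma graded_family_trivial: "graded_family R trivial_grading"
  unfolding graded_family_def trivial_grading_def by auto

text \<open>This models \<open>R[y1 t, ..., ys t]\<close>, built one variable at a time.\<close>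

fun adjoin_list :: "'a list \<Rightarrow> nat \<Rightarrow> 'a set" where
  "adjoin_list [] = trivial_grading"
| "adjoin_list (y # ys) = adjoin (adjoin_list ys) y"

lemma graded_family_adjoin_list:
  "set ys \<subseteq> carrier R \<Longrightarrow> graded_family R (adjoin_list ys)"
  by (induction ys) (auto intro: graded_family_trivial graded_family_adjoin)

section \<open>Powers of ideals and the Rees algebra of a finitely generated ideal\<close>

abbreviation ipow :: "'a set \<Rightarrow> nat \<Rightarrow> 'a set" where
  "ipow I n \<equiv> I [^]\<^bsub>ideals_set R\<^esub> n"

lemma ideals_set_simps [simp]:
  "\<one>\<^bsub>ideals_set R\<^esub> = carrier R" "I \<otimes>\<^bsub>ideals_set R\<^esub> J = I \<cdot> J"
  by (simp_all add: ideals_set_def)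

lemma ipow_0: "ipow I 0 = carrier R"
  by simp

lemma ipow_Suc: "ipow I (Suc n) = ipow I n \<cdot> I"
  by simp

lemma ideal_ipow: "ideal I R \<Longrightarrow> ideal (ipow I n) R"
  by (induction n) (simp_all add: ipow_0 ipow_Suc oneideal ideal_prod_is_ideal)

lemma ipow_add: "ideal I R \<Longrightarrow> ipow I m \<cdot> ipow I n = ipow I (m + n)"
  using monoid.nat_pow_mult[OF comm_monoid.axioms(1)[OF ideals_set_is_comm_monoid], of I m n]
  by (simp add: ideals_set_def)

lemma ipow_ipow: "ideal I R \<Longrightarrow> ipow (ipow I m) n = ipow I (m * n)"
  using monoid.nat_pow_pow[OF comm_monoid.axioms(1)[OF ideals_set_is_comm_monoid], of I m n]
  by (simp add: ideals_set_def)

lemma ipow_1: "ideal I R \<Longrightarrow> ipow I (Suc 0) = I"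
  using ideal_prod_one ideal_prod_commute oneideal by (simp add: ipow_Suc ipow_0)

lemma ipow_mult_mem: "ideal I R \<Longrightarrow> x \<in> ipow I m \<Longrightarrow> y \<in> ipow I n \<Longrightarrow> x \<otimes> y \<in> ipow I (m + n)"
  using ipow_add ideal_prod.prod by metis

lemma ipow_antimono:
  assumes "ideal I R" "m \<le> n" shows "ipow I n \<subseteq> ipow I m"
  using ideal_prod_inter[OF ideal_ipow ideal_ipow, of I I m "n - m"] assms by (simp add: ipow_add)

lemma pow_mem_ipow:
  assumes "ideal I R" "x \<in> ipow I m" shows "x [^] n \<in> ipow I (m * n)"
proof (induction n)
  case 0
  then show ?case by (simp add: ipow_0)
next
  case (Suc n)
  then show ?case using ipow_mult_mem[OF assms(1) Suc assms(2)] by (simp add: add.commute)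
qed

lemma ideal_facts:
  assumes "ideal I R"
  shows "\<zero> \<in> I" "x \<in> I \<Longrightarrow> x \<in> carrier R" "x \<in> I \<Longrightarrow> y \<in> I \<Longrightarrow> x \<oplus> y \<in> I"
    "x \<in> I \<Longrightarrow> \<ominus> x \<in> I" "x \<in> I \<Longrightarrow> y \<in> carrier R \<Longrightarrow> y \<otimes> x \<in> I"
    "x \<in> I \<Longrightarrow> y \<in> carrier R \<Longrightarrow> x \<otimes> y \<in> I"
proof -
  interpret ideal I R by fact
  show "\<zero> \<in> I" "x \<in> I \<Longrightarrow> x \<in> carrier R" "x \<in> I \<Longrightarrow> y \<in> I \<Longrightarrow> x \<oplus> y \<in> I"
    "x \<in> I \<Longrightarrow> \<ominus> x \<in> I" "x \<in> I \<Longrightarrow> y \<in> carrier R \<Longrightarrow> y \<otimes> x \<in> I"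
    "x \<in> I \<Longrightarrow> y \<in> carrier R \<Longrightarrow> x \<otimes> y \<in> I"
    by (auto intro: I_l_closed I_r_closed)
qed

lemma graded_family_ipow: "ideal I R \<Longrightarrow> graded_family R (ipow I)"
  unfolding graded_family_def
  using ideal_facts[OF ideal_ipow] ipow_mult_mem by (auto simp: ipow_0)

lemma ideal_crit:
  assumes "I \<subseteq> carrier R" "\<zero> \<in> I" "\<And>x y. x \<in> I \<Longrightarrow> y \<in> I \<Longrightarrow> x \<oplus> y \<in> I"
    and mult: "\<And>r x. r \<in> carrier R \<Longrightarrow> x \<in> I \<Longrightarrow> r \<otimes> x \<in> I"
  shows "ideal I R"
proof (rule idealI)
  have "\<ominus> x \<in> I" if "x \<in> I" for x
    using mult[OF _ that, of "\<ominus> \<one>"] assms(1) that by (simp add: l_minus subset_iff)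
  then show "subgroup I (add_monoid R)"
    using assms by (intro add.subgroupI) (auto simp flip: a_inv_def)
  show "x \<otimes> r \<in> I" if "x \<in> I" "r \<in> carrier R" for x r
    using mult[OF that(2,1)] m_comm[of x r] that assms(1) by auto
qed (auto intro: ring_axioms mult)

lemma ideal_graded_component: "graded_family R A \<Longrightarrow> ideal (A n) R"
  by (rule ideal_crit) (auto intro: graded_familyD)

lemma set_subset_adjoin_list: "set ys \<subseteq> carrier R \<Longrightarrow> set ys \<subseteq> adjoin_list ys 1"
proof (induction ys)
  case (Cons y ys)
  let ?A = "adjoin_list ys"
  have A: "graded_family R ?A" and y: "y \<in> carrier R"
    using graded_family_adjoin_list Cons.prems by auto
  have "y \<in> adjoin ?A y 1"
    using gen_pow_adjoin[OF A y, of \<one> 0 1] graded_familyD(1)[OF A] y by simp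
  moreover have "x \<in> adjoin ?A y 1" if "x \<in> set ys" for x
    using gen_pow_adjoin[OF A y, of x 1 0] Cons that graded_familyD(2)[OF A, of x 1] by auto
  ultimately show ?case by auto
qed simp

lemma adjoin_list_subset_ipow:
  assumes I: "ideal I R"
  shows "set ys \<subseteq> I \<Longrightarrow> adjoin_list ys n \<subseteq> ipow I n"
proof (induction ys arbitrary: n)
  case Nil
  then show ?case using ideal_facts(1)[OF ideal_ipow[OF I]]
    by (simp add: trivial_grading_def ipow_0)
next
  case (Cons y ys)
  have "y \<in> ipow I 1" using Cons.prems ipow_1[OF I] by simp
  then have ypow: "y [^] e \<in> ipow I e" for e
    using pow_mem_ipow[OF I, of y 1 e] by simp
  have "lower (adjoin_list ys) y e n \<subseteq> ipow I n" for e
  proof (induction e)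
    case (Suc e)
    have "y [^] e \<otimes> f \<in> ipow I n" if "e \<le> n" "f \<in> adjoin_list ys (n - e)" for f
      using ipow_mult_mem[OF I ypow, of f "n - e" e] Cons that by auto
    then show ?case using Suc ideal_facts(3)[OF ideal_ipow[OF I]] by auto
  qed (use ideal_facts(1)[OF ideal_ipow[OF I]] in simp)
  then show ?case by (auto simp: adjoin_def)
qed

text \<open>The family \<open>adjoin_list ys\<close> is multiplicative and contains the generators
  in degree one, hence contains all powers of the ideal. Conversely, its elements of degree
  \<open>n\<close> are combinations of products of \<open>n\<close> generators.\<close>

lemma ipow_genideal_eq_adjoin_list:
  assumes ys: "set ys \<subseteq> carrier R"
  shows "ipow (Idl (set ys)) = adjoin_list ys"
proof
  fix n
  let ?I = "Idl (set ys)" and ?A = "adjoin_list ys"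
  have I: "ideal ?I R" by (rule genideal_ideal[OF ys])
  have A: "graded_family R ?A" by (rule graded_family_adjoin_list[OF ys])
  have gen: "?I \<subseteq> ?A 1"
    by (intro genideal_minimal ideal_graded_component A set_subset_adjoin_list ys)
  have "ipow ?I n \<subseteq> ?A n"
  proof (induction n)
    case 0
    then show ?case using graded_familyD(1)[OF A] by (simp add: ipow_0)
  next
    case (Suc n)
    show ?case
    proof
      fix x assume "x \<in> ipow ?I (Suc n)"
      then have "x \<in> ipow ?I n \<cdot> ?I" by (simp add: ipow_Suc)
      then show "x \<in> ?A (Suc n)"
      proof induction
        case (prod i j)
        then show ?case using graded_familyD(5)[OF A, of i n j 1] Suc gen by auto
      qed (rule graded_familyD(4)[OF A])
    qed
  qed
  moreover have "?A n \<subseteq> ipow ?I n"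
    by (rule adjoin_list_subset_ipow[OF I genideal_self[OF ys]])
  ultimately show "ipow ?I n = ?A n" ..
qed

end

section \<open>Noetherian Rees algebras, integral dependence and Krull's intersection
  theorem\<close>

context noetherian_domain
begin

text \<open>In degree zero \<open>hspan\<close> is an ordinary ideal of \<open>R\<close>, which is
  finitely generated; positive degrees contain only zero.\<close>

lemma graded_noetherian_trivial: "graded_noetherian R trivial_grading"
  unfolding graded_noetherian_def
proof (intro allI impI)
  fix T assume T: "T \<subseteq> homogeneous trivial_grading"
  define I where "I V = {x. (0, x) \<in> hspan R trivial_grading V}" for V
  have idealI: "ideal (I V) R" if V: "V \<subseteq> homogeneous trivial_grading" for V
  proof -
    have mult: "r \<otimes> x \<in> I V" if "x \<in> I V" "r \<in> carrier R" for r x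
      using hspan_mult[OF graded_family_trivial V, of 0 x r 0] that
      by (simp add: I_def trivial_grading_def)
    have carr: "x \<in> carrier R" if "x \<in> I V" for x
      using that hspan_homogeneous[OF graded_family_trivial V]
      by (auto simp: I_def homogeneous_def trivial_grading_def)
    show ?thesis
      by (rule ideal_crit) (use mult carr in \<open>auto simp: I_def intro: hspan.zero hspan.add\<close>)
  qed
  obtain B where B: "B \<subseteq> carrier R" "finite B" "I T = Idl B"
    using finetely_gen[OF idealI[OF T]] by blast
  have "Pair 0 ` B \<subseteq> hspan R trivial_grading T"
    using genideal_self[OF B(1)] B(3) by (auto simp: I_def)
  then obtain F where F: "F \<subseteq> T" "finite F" "Pair 0 ` B \<subseteq> hspan R trivial_grading F"
    using hspan_finite_support_set[of "Pair 0 ` B" R trivial_grading T] B(2) by blast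
  have "Idl B \<subseteq> I F"
    using F T by (intro genideal_minimal idealI) (auto simp: I_def)
  have "T \<subseteq> hspan R trivial_grading F"
  proof (rule subrelI)
    fix n x assume nx: "(n, x) \<in> T"
    show "(n, x) \<in> hspan R trivial_grading F"
    proof (cases "n = 0")
      case True
      then have "x \<in> I T"
        using hspan_superset[OF graded_family_trivial T] nx by (auto simp: I_def)
      then show ?thesis using \<open>Idl B \<subseteq> I F\<close> B(3) True by (auto simp: I_def)
    next
      case False
      then show ?thesis using nx T by (auto simp: homogeneous_def trivial_grading_def hspan.zero)
    qed
  qed
  then show "\<exists>F \<subseteq> T. finite F \<and> T \<subseteq> hspan R trivial_grading F" using F by blast
qed

text \<open>The Rees algebra arises from \<open>R\<close> by adjoining finitely many elements of
  degree one, and each adjunction preserves noetherianity.\<close>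

lemma graded_noetherian_ipow:
  assumes "ideal I R" shows "graded_noetherian R (ipow I)"
proof -
  obtain B where B: "B \<subseteq> carrier R" "finite B" "I = Idl B"
    using finetely_gen[OF assms] by blast
  then obtain ys where ys: "B = set ys" using finite_list by blast
  have "set ys \<subseteq> carrier R \<Longrightarrow> graded_noetherian R (adjoin_list ys)" for ys
    by (induction ys)
      (auto intro: graded_noetherian_trivial graded_noetherian_adjoin graded_family_adjoin_list)
  then show ?thesis using B ys ipow_genideal_eq_adjoin_list by metis
qed

text \<open>The chain condition for sequences: every term is a combination of the first
  \<open>M\<close>. The bound \<open>M \<ge> 1\<close> later gives an equation of integral
  dependence its positive degree.\<close>

lemma range_generated_by_initial_segment:
  assumes "ideal K R" and "\<And>k::nat. u k \<in> homogeneous (ipow K)"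
  shows "\<exists>M\<ge>1. range u \<subseteq> hspan R (ipow K) (u ` {..<M})"
proof -
  have "range u \<subseteq> homogeneous (ipow K)" using assms(2) by auto
  then obtain F where F: "F \<subseteq> range u" "finite F" "range u \<subseteq> hspan R (ipow K) F"
    using graded_noetherian_ipow[OF assms(1), unfolded graded_noetherian_def, rule_format, of "range u"]
    by metis
  obtain I where I: "finite I" "F = u ` I" using F finite_subset_image by metis
  obtain M where "I \<subseteq> {..<M}" using finite_nat_iff_bounded I(1) by blast
  then have "F \<subseteq> u ` {..<Suc M}" using I(2) by auto
  then show ?thesis using F(3) hspan_mono[of F "u ` {..<Suc M}" R "ipow K"]
    by (intro exI[of _ "Suc M"]) auto
qed

text \<open>The elements \<open>g w^k t^k\<close> generate a finitely generated homogeneous ideal of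
  the Rees algebra of \<open>K\<close>. Writing one of them through its predecessors and cancelling
  \<open>g\<close> in the domain leaves the equation of integral dependence.\<close>

lemma almost_integral_imp_integral:
  assumes K: "ideal K R" and g: "g \<in> carrier R" "g \<noteq> \<zero>" and w: "w \<in> carrier R"
    and gw: "\<And>k::nat. g \<otimes> w [^] k \<in> ipow K k"
  shows "w \<in> integral_closure R K"
proof -
  define u where "u k = (k, g \<otimes> w [^] k)" for k :: nat
  have "u k \<in> homogeneous (ipow K)" for k using gw by (simp add: u_def homogeneous_def)
  then obtain N where N: "N \<ge> 1" "range u \<subseteq> hspan R (ipow K) (u ` {..<N})"
    using range_generated_by_initial_segment[OF K, of u] by blast
  \<comment> \<open>A multiplier \<open>r\<close> of degree \<open>m\<close> on the generator of
    index \<open>d\<close> becomes the coefficient of \<open>w ^ d\<close>; it lies in the power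
    \<open>m = (m + d) - d\<close> of \<open>K\<close>. In degree \<open>N\<close> the condition
    covers every index \<open>j < N\<close>.\<close>
  have "\<exists>c. (\<forall>j. c j \<in> carrier R) \<and> (\<forall>j\<le>n. c j \<in> ipow K (n - j)) \<and>
      f = g \<otimes> (\<Oplus>j\<in>{..<N}. c j \<otimes> w [^] j)"
    if "(n, f) \<in> hspan R (ipow K) (u ` {..<N})" for n f
    using that
  proof induction
    case (zero n)
    then show ?case
      using w g ideal_facts(1)[OF ideal_ipow[OF K]] by (intro exI[of _ "\<lambda>_. \<zero>"]) simp
  next
    case (gen d x r m)
    then have x: "x = g \<otimes> w [^] d" and d: "d < N" by (auto simp: u_def)
    have r: "r \<in> carrier R" using ideal_facts(2)[OF ideal_ipow[OF K] gen(2)] .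
    define c where "c j = (if d = j then r else \<zero>)" for j
    have "(\<Oplus>j\<in>{..<N}. c j \<otimes> w [^] j) = (\<Oplus>j\<in>{..<N}. if d = j then r \<otimes> w [^] j else \<zero>)"
      using r w by (intro finsum_cong') (auto simp: c_def)
    also have "\<dots> = r \<otimes> w [^] d" using d r w by (intro finsum_singleton) auto
    finally have "r \<otimes> x = g \<otimes> (\<Oplus>j\<in>{..<N}. c j \<otimes> w [^] j)"
      unfolding x using g r w by (simp add: m_lcomm)
    then show ?case
      using r gen(2) ideal_facts(1)[OF ideal_ipow[OF K]]
      by (intro exI[of _ c]) (auto simp: c_def)
  next
    case (add n f f')
    obtain c where c: "\<And>j. c j \<in> carrier R" "\<And>j. j \<le> n \<Longrightarrow> c j \<in> ipow K (n - j)"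
      "f = g \<otimes> (\<Oplus>j\<in>{..<N}. c j \<otimes> w [^] j)" using add.IH by blast
    obtain c' where c': "\<And>j. c' j \<in> carrier R" "\<And>j. j \<le> n \<Longrightarrow> c' j \<in> ipow K (n - j)"
      "f' = g \<otimes> (\<Oplus>j\<in>{..<N}. c' j \<otimes> w [^] j)" using add.IH by blast
    have "f \<oplus> f' = g \<otimes> (\<Oplus>j\<in>{..<N}. c j \<otimes> w [^] j \<oplus> c' j \<otimes> w [^] j)"
      unfolding c(3) c'(3) using c(1) c'(1) w g by (simp add: r_distr finsum_addf Pi_def)
    also have "\<dots> = g \<otimes> (\<Oplus>j\<in>{..<N}. (c j \<oplus> c' j) \<otimes> w [^] j)"
      using c(1) c'(1) w by (simp add: l_distr)
    finally show ?case
      using c(1,2) c'(1,2) ideal_facts(3)[OF ideal_ipow[OF K]]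
      by (intro exI[of _ "\<lambda>j. c j \<oplus> c' j"]) auto
  qed
  from this[of N "g \<otimes> w [^] N"] N(2) obtain c where c: "\<And>j. c j \<in> carrier R"
    "\<And>j. j \<le> N \<Longrightarrow> c j \<in> ipow K (N - j)"
    "g \<otimes> w [^] N = g \<otimes> (\<Oplus>j\<in>{..<N}. c j \<otimes> w [^] j)"
    unfolding u_def by blast
  have wN: "w [^] N = (\<Oplus>j\<in>{..<N}. c j \<otimes> w [^] j)"
    using c(3) g w c(1) m_lcancel[of g "w [^] N"] by (simp add: Pi_def)
  have img: "(\<lambda>i. N - i) ` {1..N} = {..<N}"
  proof
    show "{..<N} \<subseteq> (\<lambda>i. N - i) ` {1..N}"
    proof
      fix j assume "j \<in> {..<N}"
      then show "j \<in> (\<lambda>i. N - i) ` {1..N}" by (intro image_eqI[of _ _ "N - j"]) auto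
    qed
  qed auto
  have inj: "inj_on (\<lambda>i. N - i) {1..N}" by (auto simp: inj_on_def)
  have "(\<Oplus>i\<in>{1..N}. \<ominus> c (N - i) \<otimes> w [^] (N - i)) = (\<Oplus>j\<in>{..<N}. \<ominus> c j \<otimes> w [^] j)"
    using inj finsum_reindex[of "\<lambda>j. \<ominus> c j \<otimes> w [^] j" "\<lambda>i. N - i" "{1..N}"] c(1) w
    unfolding img by (simp add: Pi_def)
  then have "w [^] N \<oplus> (\<Oplus>i\<in>{1..N}. \<ominus> c (N - i) \<otimes> w [^] (N - i)) =
      (\<Oplus>j\<in>{..<N}. c j \<otimes> w [^] j \<oplus> \<ominus> c j \<otimes> w [^] j)"
    unfolding wN using c(1) w by (simp add: finsum_addf Pi_def)
  also have "\<dots> = \<zero>" using c(1) w by (simp add: l_minus r_neg)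
  finally have eq: "w [^] N \<oplus> (\<Oplus>i\<in>{1..N}. \<ominus> c (N - i) \<otimes> w [^] (N - i)) = \<zero>" .
  have mem: "\<forall>i\<in>{1..N}. \<ominus> c (N - i) \<in> ipow K i"
  proof
    fix i assume "i \<in> {1..N}"
    then show "\<ominus> c (N - i) \<in> ipow K i"
      using c(2)[of "N - i"] ideal_facts(4)[OF ideal_ipow[OF K], of "c (N - i)" i] by simp
  qed
  show ?thesis
    unfolding integral_closure_def
    by (rule CollectI, intro conjI exI[of _ N] exI[of _ "\<lambda>i. \<ominus> c (N - i)"])
      (use w N(1) eq mem in simp_all)
qed

text \<open>If \<open>w\<close> lies in all powers, then all \<open>w t^r\<close> are generated by
  those with \<open>r < N\<close>. In degree \<open>N\<close> this reads \<open>w = y w\<close> with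
  \<open>y\<close> in \<open>J\<close>, so \<open>y = 1\<close> in a domain.\<close>

lemma krull_intersection:
  assumes J: "ideal J R" and w: "\<And>r. w \<in> ipow J r" "w \<noteq> \<zero>"
  shows "J = carrier R"
proof -
  define u where "u r = (r, w)" for r :: nat
  have "u k \<in> homogeneous (ipow J)" for k using w by (simp add: u_def homogeneous_def)
  then obtain N where N: "range u \<subseteq> hspan R (ipow J) (u ` {..<N})"
    using range_generated_by_initial_segment[OF J, of u] by blast
  have wc: "w \<in> carrier R" using w(1)[of 0] by simp
  \<comment> \<open>In degree at least \<open>N\<close> every generator, having degree below
    \<open>N\<close>, carries a multiplier of positive degree, hence one in
    \<open>J\<close>.\<close>
  have "N \<le> n \<longrightarrow> (\<exists>y\<in>J. f = y \<otimes> w)" if "(n, f) \<in> hspan R (ipow J) (u ` {..<N})" for n f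
    using that
  proof induction
    case (zero n)
    then show ?case using wc ideal_facts(1)[OF J] by (intro impI bexI[of _ \<zero>]) auto
  next
    case (gen d x r m)
    then have "x = w" "d < N" by (auto simp: u_def)
    moreover have "r \<in> J" if "m \<ge> 1" using ipow_antimono[OF J that] gen ipow_1[OF J] by auto
    ultimately show ?case by auto
  next
    case (add n f f')
    show ?case
    proof
      assume "N \<le> n"
      then obtain y y' where y: "y \<in> J" "f = y \<otimes> w" "y' \<in> J" "f' = y' \<otimes> w" using add.IH by blast
      then have "f \<oplus> f' = (y \<oplus> y') \<otimes> w" using wc ideal_facts(2)[OF J] by (simp add: l_distr)
      then show "\<exists>y\<in>J. f \<oplus> f' = y \<otimes> w" using y ideal_facts(3)[OF J] by blast
    qed
  qed
  from this[of N w] N obtain y where y: "y \<in> J" "w = y \<otimes> w" unfolding u_def by blast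
  then have "y = \<one>" using wc w(2) ideal_facts(2)[OF J y(1)] m_rcancel[of w y \<one>] by simp
  then show ?thesis using y ideal.one_imp_carrier[OF J] by simp
qed

end

section \<open>Filtrations and Rees algebras\<close>

context cring
begin

lemma finsum_mem_ideal:
  assumes I: "ideal I R" and "finite B" "\<And>i. i \<in> B \<Longrightarrow> f i \<in> I"
  shows "finsum R f B \<in> I"
  using assms(2,3)
proof (induction B)
  case (insert i B)
  then have "f \<in> B \<rightarrow> carrier R" "f i \<in> carrier R" using ideal_facts(2)[OF I] by auto
  then show ?case using insert ideal_facts(3)[OF I] by simp
qed (simp add: ideal_facts(1)[OF I])

lemma subring_rees_algebra:
  assumes A: "graded_family R A"
  shows "subring (rees_algebra R A) (UP R)"
proof -
  interpret U: UP_cring R "UP R" by unfold_locales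
  show ?thesis
  proof (rule U.P.subringI)
    fix p q assume p: "p \<in> rees_algebra R A" and q: "q \<in> rees_algebra R A"
    have "coeff (UP R) p i \<otimes> coeff (UP R) q (n - i) \<in> A n" if "i \<in> {..n}" for i n
      using graded_familyD(5)[OF A, of "coeff (UP R) p i" i "coeff (UP R) q (n - i)" "n - i"]
        p q that by (simp add: rees_algebra_def)
    then show "p \<otimes>\<^bsub>UP R\<^esub> q \<in> rees_algebra R A"
      using p q ideal_graded_component[OF A] by (auto simp: rees_algebra_def intro: finsum_mem_ideal)
  qed (use graded_familyD[OF A] in \<open>auto simp: rees_algebra_def\<close>)
qed

lemma ideal_filtrationD:
  assumes a: "ideal_filtration R a"
  shows "a 0 = carrier R" "ideal (a n) R" "m \<le> n \<Longrightarrow> a n \<subseteq> a m"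
    "x \<in> a m \<Longrightarrow> y \<in> a n \<Longrightarrow> x \<otimes> y \<in> a (m + n)"
proof -
  show a0: "a 0 = carrier R" using a by (simp add: ideal_filtration_def)
  show ideal: "ideal (a n) R" for n
    using a oneideal by (cases "n = 0") (auto simp: ideal_filtration_def)
  have "a (Suc n) \<subseteq> a n" for n
    using a ideal_facts(2)[OF ideal, of _ 1] by (cases "n = 0") (auto simp: ideal_filtration_def)
  then show "m \<le> n \<Longrightarrow> a n \<subseteq> a m" by (rule lift_Suc_antimono_le)
  have prod: "a m \<cdot> a n \<subseteq> a (m + n)" if "m \<ge> 1" "n \<ge> 1" using a that by (simp add: ideal_filtration_def)
  show "x \<otimes> y \<in> a (m + n)" if "x \<in> a m" "y \<in> a n"
  proof -
    have c: "x \<in> carrier R" "y \<in> carrier R" using that ideal_facts(2)[OF ideal] by auto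
    consider "m = 0" | "n = 0" | "m \<ge> 1" "n \<ge> 1" by linarith
    then show ?thesis
    proof cases
      case 3
      then show ?thesis using prod ideal_prod.prod[OF that, of R] by blast
    qed (use that c ideal_facts(5,6)[OF ideal] in auto)
  qed
qed

lemma ipow_subset_filtration:
  assumes a: "ideal_filtration R a" shows "ipow (a k) n \<subseteq> a (k * n)"
proof (induction n)
  case 0
  then show ?case using ideal_filtrationD(1)[OF a] by simp
next
  case (Suc n)
  show ?case
  proof
    fix x assume "x \<in> ipow (a k) (Suc n)"
    then have "x \<in> ipow (a k) n \<cdot> a k" by simp
    then show "x \<in> a (k * Suc n)"
    proof induction
      case (prod i j)
      then show ?case using ideal_filtrationD(4)[OF a, of i "k * n" j k] Suc by (auto simp: add.commute)
    qed (rule ideal_facts(3)[OF ideal_filtrationD(2)[OF a]])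
  qed
qed

text \<open>The polynomials with coefficients in the powers of \<open>a k\<close> form a subring
  that contains the given generators, so it contains the Veronese algebra; comparing coefficients of
  monomials gives the nontrivial inclusion.\<close>

lemma veronese_standard_gradedD:
  assumes a: "ideal_filtration R a" and k: "k \<ge> 1" and std: "veronese_standard_graded R k a"
  shows "a (k * n) = ipow (a k) n"
proof
  interpret U: UP_cring R "UP R" by unfold_locales
  \<comment> \<open>The powers of \<open>a k\<close> spread out to the degrees divisible by
    \<open>k\<close>, with zero elsewhere.\<close>
  define B where "B m = (if k dvd m then ipow (a k) (m div k) else {\<zero>})" for m
  have ak: "ideal (a k) R" by (rule ideal_filtrationD(2)[OF a])
  have "x \<otimes> y \<in> B (m + n)" if "x \<in> B m" "y \<in> B n" for x y m n
  proof (cases "k dvd m \<and> k dvd n")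
    case True
    then show ?thesis
      using that ipow_mult_mem[OF ak, of x "m div k" y "n div k"] by (simp add: B_def div_add)
  next
    case False
    moreover have "x \<in> carrier R" "y \<in> carrier R"
      using that ideal_facts(2)[OF ideal_ipow[OF ak]] by (auto simp: B_def split: if_splits)
    ultimately have "x \<otimes> y = \<zero>" using that by (auto simp: B_def split: if_splits)
    then show ?thesis using ideal_facts(1)[OF ideal_ipow[OF ak]] by (simp add: B_def)
  qed
  then have B: "graded_family R B"
    unfolding graded_family_def using ideal_facts[OF ideal_ipow[OF ak]] by (auto simp: B_def)
  have ak_carrier: "a k \<subseteq> carrier R" using ideal_facts(2)[OF ak] by blast
  have gens: "{monom (UP R) s 0 |s. s \<in> carrier R} \<union> {monom (UP R) x k |x. x \<in> a k}
      \<subseteq> rees_algebra R B"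
    using subsetD[OF ak_carrier] k ipow_1[OF ak] ideal_facts(1)[OF ideal_ipow[OF ak]]
    by (auto simp: rees_algebra_def B_def)
  have sub: "rees_veronese R k a \<subseteq> rees_algebra R B"
    unfolding std[unfolded veronese_standard_graded_def]
    by (rule U.P.generate_ring_min_subring1[OF _ subring_rees_algebra[OF B] gens])
      (use gens in \<open>auto simp: rees_algebra_def\<close>)
  show "a (k * n) \<subseteq> ipow (a k) n"
  proof
    fix x assume x: "x \<in> a (k * n)"
    have xc: "x \<in> carrier R" using ideal_facts(2)[OF ideal_filtrationD(2)[OF a] x] .
    have "monom (UP R) x (k * n) \<in> rees_veronese R k a"
      using x xc ideal_facts(1)[OF ideal_filtrationD(2)[OF a]]
      by (auto simp: rees_veronese_def rees_algebra_def)
    then have "monom (UP R) x (k * n) \<in> rees_algebra R B" using sub by blast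
    then have "coeff (UP R) (monom (UP R) x (k * n)) (k * n) \<in> B (k * n)"
      by (simp add: rees_algebra_def)
    then show "x \<in> ipow (a k) n" using xc k by (simp add: B_def)
  qed
  show "ipow (a k) n \<subseteq> a (k * n)" by (rule ipow_subset_filtration[OF a])
qed

text \<open>If \<open>D\<close> bounds the degrees of the module generators, then the coefficient of
  degree \<open>n\<close> in a combination of them involves only multiplier coefficients of degree
  at least \<open>n - D\<close>, and these lie in \<open>b (n - D)\<close>.\<close>

lemma finitely_generated_rees_shift:
  assumes b: "ideal_filtration R b"
    and c: "\<And>n. c n \<subseteq> carrier R" "\<And>n. \<zero> \<in> c n"
    and fg: "finitely_generated_over (UP R) (rees_algebra R b) (rees_algebra R c)"
  shows "\<exists>D. \<forall>n\<ge>D. c n \<subseteq> b (n - D)"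
proof -
  interpret U: UP_cring R "UP R" by unfold_locales
  obtain X where X: "finite X" "X \<subseteq> rees_algebra R c"
    and eq: "rees_algebra R c =
      {(\<Oplus>\<^bsub>UP R\<^esub>x\<in>X. f x \<otimes>\<^bsub>UP R\<^esub> x) | f. f \<in> X \<rightarrow> rees_algebra R b}"
    using fg unfolding finitely_generated_over_def by blast
  define D where "D = (\<Sum>x\<in>X. deg R x)"
  have XP: "x \<in> carrier (UP R)" if "x \<in> X" for x using X that by (auto simp: rees_algebra_def)
  have D: "coeff (UP R) x j = \<zero>" if "x \<in> X" "D < j" for x j
  proof -
    have "deg R x \<le> D" unfolding D_def using X(1) that by (intro member_le_sum) auto
    then show ?thesis using that XP by (intro U.deg_aboveD) auto
  qed
  have "w \<in> b (n - D)" if w: "w \<in> c n" for n w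
  proof -
    have wc: "w \<in> carrier R" using w c by blast
    have "monom (UP R) w n \<in> rees_algebra R c" using w wc c by (simp add: rees_algebra_def)
    then obtain f where f: "f \<in> X \<rightarrow> rees_algebra R b"
      and meq: "monom (UP R) w n = (\<Oplus>\<^bsub>UP R\<^esub>x\<in>X. f x \<otimes>\<^bsub>UP R\<^esub> x)"
      unfolding eq by blast
    have fP: "f x \<in> carrier (UP R)" if "x \<in> X" for x using f that by (auto simp: rees_algebra_def)
    have "coeff (UP R) (f x \<otimes>\<^bsub>UP R\<^esub> x) n \<in> b (n - D)" if x: "x \<in> X" for x
    proof -
      have "coeff (UP R) (f x) i \<otimes> coeff (UP R) x (n - i) \<in> b (n - D)" if "i \<in> {..n}" for i
      proof (cases "D < n - i")
        case True
        then show ?thesis using D[OF x] fP[OF x] ideal_facts(1)[OF ideal_filtrationD(2)[OF b]] by simp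
      next
        case False
        have "coeff (UP R) (f x) i \<in> b i" using f x by (auto simp: rees_algebra_def)
        moreover have "n - D \<le> i" using False by simp
        ultimately have "coeff (UP R) (f x) i \<in> b (n - D)"
          using ideal_filtrationD(3)[OF b, of "n - D" i] by blast
        then show ?thesis using ideal_facts(6)[OF ideal_filtrationD(2)[OF b]] XP[OF x] by simp
      qed
      then show ?thesis
        using fP[OF x] XP[OF x] by (auto intro!: finsum_mem_ideal ideal_filtrationD(2)[OF b])
    qed
    then have "(\<Oplus>x\<in>X. coeff (UP R) (f x \<otimes>\<^bsub>UP R\<^esub> x) n) \<in> b (n - D)"
      using X(1) by (intro finsum_mem_ideal ideal_filtrationD(2)[OF b])
    also have "(\<Oplus>x\<in>X. coeff (UP R) (f x \<otimes>\<^bsub>UP R\<^esub> x) n) = coeff (UP R) (monom (UP R) w n) n"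
      unfolding meq using X(1) fP XP by (subst U.coeff_finsum) auto
    finally show ?thesis using wc by simp
  qed
  then show ?thesis by blast
qed

lemma subset_integral_closure:
  assumes "ideal I R" shows "I \<subseteq> integral_closure R I"
proof
  fix x assume x: "x \<in> I"
  have xc: "x \<in> carrier R" using ideal_facts(2)[OF assms x] .
  show "x \<in> integral_closure R I"
    unfolding integral_closure_def
    by (rule CollectI, intro conjI exI[of _ 1] exI[of _ "\<lambda>_. \<ominus> x"])
      (use xc x ipow_1[OF assms] ideal_facts(4)[OF assms] in \<open>auto simp: r_neg\<close>)
qed

end

section \<open>Superadditive order functions\<close>

text \<open>Starting at 1 and stepping by elements of \<open>M\<close>, \<open>v\<close> increases
  at a rate of at most the largest slope in \<open>M\<close>, so it stays below that line up to a
  constant on an unbounded set. By superadditivity a larger slope anywhere would eventually exceed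
  any constant.\<close>

lemma superadditive_slope_attained:
  fixes v :: "nat \<Rightarrow> nat"
  assumes super: "\<And>m n. v m + v n \<le> v (m + n)"
    and M: "finite M" "0 \<notin> M"
    and step: "\<And>n. n \<ge> 1 \<Longrightarrow> \<exists>j\<in>M. v (n + j) = v n + v j"
  shows "\<exists>j\<ge>1. \<forall>n. v n * j \<le> v j * n"
proof -
  have "M \<noteq> {}" using step[of 1] by auto
  then obtain j where j: "j \<in> M" "\<And>i. i \<in> M \<Longrightarrow> real (v i) / real i \<le> real (v j) / real j"
    using M(1) Max_in[of "(\<lambda>i. real (v i) / real i) ` M"] Max_ge[of "(\<lambda>i. real (v i) / real i) ` M"]
    by (smt (verit, ccfv_threshold) finite_imageI image_iff image_is_empty)
  have j1: "j \<ge> 1" using j(1) M(2) by (cases j) auto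
  have max: "v i * j \<le> v j * i" if "i \<in> M" for i
  proof -
    have "i > 0" using that M(2) by (cases i) auto
    then have "real (v i * j) \<le> real (v j * i)" using j(2)[OF that] j1 by (simp add: field_simps)
    then show ?thesis by (simp only: of_nat_le_iff)
  qed
  have v0: "v 0 = 0" using super[of 0 0] by simp
  have mono: "v m \<le> v n" if "m \<le> n" for m n using super[of m "n - m"] that by simp
  have mult: "k * v m \<le> v (k * m)" for k m
  proof (induction k)
    case (Suc k)
    then show ?case using super[of m "k * m"] by simp
  qed simp
  \<comment> \<open>The term \<open>v 1 * j\<close> accounts for the starting point 1.\<close>
  have path: "\<exists>n\<ge>N. n \<ge> 1 \<and> v n * j \<le> v j * n + v 1 * j" for N
  proof (induction N)
    case 0
    then show ?case by (intro exI[of _ 1]) simp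
  next
    case (Suc N)
    then obtain n where n: "n \<ge> N" "n \<ge> 1" "v n * j \<le> v j * n + v 1 * j" by blast
    obtain i where i: "i \<in> M" "v (n + i) = v n + v i" using step[OF n(2)] by blast
    have "i \<ge> 1" using i(1) M(2) by (cases i) auto
    moreover have "v (n + i) * j \<le> v j * (n + i) + v 1 * j"
      unfolding i(2) using n(3) max[OF i(1)] by (simp add: algebra_simps)
    ultimately show ?case using n by (intro exI[of _ "n + i"]) auto
  qed
  have "v m * j \<le> v j * m" for m
  proof (rule ccontr)
    assume "\<not> ?thesis"
    then have lt: "v j * m + 1 \<le> v m * j" by simp
    then have m: "m \<ge> 1" using v0 by (cases m) auto
    \<comment> \<open>Each block of length \<open>m\<close> gains at least one over the line.
      \<open>C\<close> exceeds the total allowance: \<open>v j * m\<close> for rounding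
      \<open>n\<close> up to a multiple of \<open>m\<close>, and \<open>v 1 * j\<close> from the
      path.\<close>
    define C where "C = v j * m + v 1 * j + 1"
    obtain n where n: "n \<ge> m * C" "v n * j \<le> v j * n + v 1 * j" using path[of "m * C"] by blast
    define q where "q = n div m"
    have q: "C \<le> q" using n(1) m unfolding q_def by (simp add: less_eq_div_iff_mult_less_eq mult.commute)
    have n_bounds: "q * m \<le> n" "n \<le> (q + 1) * m"
      unfolding q_def using m by (simp_all add: dividend_less_div_times less_imp_le add.commute)
    have "q * (v j * m + 1) \<le> q * (v m * j)" using lt by (rule mult_le_mono2)
    also have "\<dots> \<le> v (q * m) * j" using mult[of q m] by (simp add: mult.assoc[symmetric])
    also have "\<dots> \<le> v n * j" using mono[OF n_bounds(1)] by simp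
    also have "\<dots> \<le> v j * n + v 1 * j" by (rule n(2))
    also have "\<dots> \<le> v j * ((q + 1) * m) + v 1 * j" using n_bounds(2) by simp
    finally show False using q unfolding C_def by (simp add: algebra_simps)
  qed
  then show ?thesis using j1 by blast
qed

section \<open>Integral closures of powers and their order function\<close>

context noetherian_domain
begin

text \<open>Since the ring is Noetherian this is the integral closure of \<open>J ^ r\<close>; in this form closure under
  sums and products is elementary.\<close>

definition almost_integral :: "'a set \<Rightarrow> nat \<Rightarrow> 'a set" where
  "almost_integral J r =
     {w \<in> carrier R. \<exists>g \<in> carrier R. g \<noteq> \<zero> \<and> (\<forall>n::nat. g \<otimes> w [^] n \<in> ipow J (r * n))}"

lemma almost_integralD:
  assumes "w \<in> almost_integral J r"
  shows "w \<in> carrier R"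
    and "\<exists>g \<in> carrier R. g \<noteq> \<zero> \<and> (\<forall>n::nat. g \<otimes> w [^] n \<in> ipow J (r * n))"
  using assms unfolding almost_integral_def by auto

lemma almost_integralI:
  assumes "w \<in> carrier R" "g \<in> carrier R" "g \<noteq> \<zero>" "\<And>n::nat. g \<otimes> w [^] n \<in> ipow J (r * n)"
  shows "w \<in> almost_integral J r"
  using assms unfolding almost_integral_def by blast

context
  fixes J
  assumes J: "ideal J R"
begin

lemma ipow_subset_almost_integral: "ipow J r \<subseteq> almost_integral J r"
proof
  fix w assume w: "w \<in> ipow J r"
  have wc: "w \<in> carrier R" using ideal_facts(2)[OF ideal_ipow[OF J] w] .
  show "w \<in> almost_integral J r"
    by (rule almost_integralI[of _ \<one>]) (use wc pow_mem_ipow[OF J w] in auto)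
qed

lemma almost_integral_antimono:
  assumes "r \<le> s" shows "almost_integral J s \<subseteq> almost_integral J r"
proof
  fix w assume w: "w \<in> almost_integral J s"
  then obtain g where "g \<in> carrier R" "g \<noteq> \<zero>" "\<And>n::nat. g \<otimes> w [^] n \<in> ipow J (s * n)"
    using almost_integralD by blast
  moreover have "ipow J (s * n) \<subseteq> ipow J (r * n)" for n
    using assms by (intro ipow_antimono J mult_right_mono) auto
  ultimately show "w \<in> almost_integral J r" using almost_integralD(1)[OF w]
    by (intro almost_integralI[of _ g]) auto
qed

lemma almost_integral_mult:
  assumes w: "w \<in> almost_integral J r" and w': "w' \<in> almost_integral J s"
  shows "w \<otimes> w' \<in> almost_integral J (r + s)"
proof -
  obtain g where g: "g \<in> carrier R" "g \<noteq> \<zero>" "\<And>n::nat. g \<otimes> w [^] n \<in> ipow J (r * n)"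
    using almost_integralD[OF w] by blast
  obtain g' where g': "g' \<in> carrier R" "g' \<noteq> \<zero>" "\<And>n::nat. g' \<otimes> w' [^] n \<in> ipow J (s * n)"
    using almost_integralD[OF w'] by blast
  have c: "w \<in> carrier R" "w' \<in> carrier R" using w w' almost_integralD(1) by auto
  show ?thesis
  proof (rule almost_integralI[of _ "g \<otimes> g'"])
    fix n :: nat
    have "(g \<otimes> g') \<otimes> (w \<otimes> w') [^] n = (g \<otimes> w [^] n) \<otimes> (g' \<otimes> w' [^] n)"
      using g g' c by (simp add: nat_pow_distrib m_ac)
    then show "(g \<otimes> g') \<otimes> (w \<otimes> w') [^] n \<in> ipow J ((r + s) * n)"
      using ipow_mult_mem[OF J g(3) g'(3)] by (simp add: distrib_right)
  qed (use g g' c integral_iff in auto)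
qed

lemma almost_integral_add:
  assumes w: "w \<in> almost_integral J r" and w': "w' \<in> almost_integral J r"
  shows "w \<oplus> w' \<in> almost_integral J r"
proof -
  obtain g where g: "g \<in> carrier R" "g \<noteq> \<zero>" "\<And>n::nat. g \<otimes> w [^] n \<in> ipow J (r * n)"
    using almost_integralD[OF w] by blast
  obtain g' where g': "g' \<in> carrier R" "g' \<noteq> \<zero>" "\<And>n::nat. g' \<otimes> w' [^] n \<in> ipow J (r * n)"
    using almost_integralD[OF w'] by blast
  have c: "w \<in> carrier R" "w' \<in> carrier R" using w w' almost_integralD(1) by auto
  \<comment> \<open>In place of the binomial theorem, one factor \<open>w + w'\<close> at a time is
    distributed, with the exponents \<open>i\<close> and \<open>j\<close> kept general for the
    induction.\<close>
  have *: "(g \<otimes> w [^] i) \<otimes> (g' \<otimes> w' [^] j) \<otimes> (w \<oplus> w') [^] n \<in> ipow J (r * (i + j + n))"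
    for i j n :: nat
  proof (induction n arbitrary: i j)
    case 0
    then show ?case using ipow_mult_mem[OF J g(3)[of i] g'(3)[of j]] g g' c
      by (simp add: distrib_left)
  next
    case (Suc n)
    have "(g \<otimes> w [^] i) \<otimes> (g' \<otimes> w' [^] j) \<otimes> (w \<oplus> w') [^] Suc n =
        (g \<otimes> w [^] Suc i) \<otimes> (g' \<otimes> w' [^] j) \<otimes> (w \<oplus> w') [^] n \<oplus>
        (g \<otimes> w [^] i) \<otimes> (g' \<otimes> w' [^] Suc j) \<otimes> (w \<oplus> w') [^] n"
    proof -
      define Q where "Q = (w \<oplus> w') [^] n"
      have "Q \<in> carrier R" using c by (simp add: Q_def)
      then show ?thesis
        using g g' c unfolding nat_pow_Suc Q_def[symmetric] by (simp add: r_distr l_distr m_ac)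
    qed
    then show ?case
      using Suc[of "Suc i" j] Suc[of i "Suc j"] ideal_facts(3)[OF ideal_ipow[OF J]] by simp
  qed
  show ?thesis
    by (rule almost_integralI[of _ "g \<otimes> g'"])
      (use *[of 0 0] g g' c integral_iff in auto)
qed

lemma almost_integral_imp_integral_closure:
  assumes w: "w \<in> almost_integral J r" shows "w \<in> integral_closure R (ipow J r)"
proof -
  obtain g where "g \<in> carrier R" "g \<noteq> \<zero>" "\<And>n::nat. g \<otimes> w [^] n \<in> ipow J (r * n)"
    using almost_integralD[OF w] by blast
  then show ?thesis
    using almost_integralD(1)[OF w] by (intro almost_integral_imp_integral[of _ g])
      (auto simp: ipow_ipow[OF J] ideal_ipow[OF J])
qed

end

text \<open>One multiplier \<open>d\<close> serves all \<open>r\<close> at once: it makes up for the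
  shift by \<open>D\<close> when \<open>D \<le> l * r\<close>, and otherwise already lies in
  \<open>b (l * r)\<close> itself.\<close>

lemma almost_integral_conductor:
  assumes b: "ideal_filtration R b" and bJ: "\<And>n. b (l * n) = ipow (b l) n"
    and D: "\<And>n. n \<ge> D \<Longrightarrow> integral_closure R (b n) \<subseteq> b (n - D)"
    and d: "d \<in> b D" and w: "w \<in> almost_integral (b l) r"
  shows "d \<otimes> w \<in> ipow (b l) r"
proof -
  have bl: "ideal (b l) R" by (rule ideal_filtrationD(2)[OF b])
  have wc: "w \<in> carrier R" using almost_integralD(1)[OF w] .
  show ?thesis
  proof (cases "D \<le> l * r")
    case True
    have "w \<in> integral_closure R (b (l * r))"
      using almost_integral_imp_integral_closure[OF bl w] by (simp add: bJ)
    then have "w \<in> b (l * r - D)" using D[OF True] by blast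
    then have "d \<otimes> w \<in> b (D + (l * r - D))" by (rule ideal_filtrationD(4)[OF b d])
    then show ?thesis using True by (simp add: bJ)
  next
    case False
    then have "d \<in> b (l * r)" using ideal_filtrationD(3)[OF b, of "l * r" D] d by auto
    then show ?thesis using ideal_facts(6)[OF ideal_ipow[OF bl]] wc by (simp add: bJ)
  qed
qed

text \<open>The quotient \<open>p / q\<close> is the supremum of \<open>v n / n\<close> for the
  order function \<open>v\<close>, attained at \<open>q\<close> with \<open>p = v q\<close>.\<close>

lemma order_slope_exists:
  assumes I: "ideal I R" and J: "ideal J R" "J \<noteq> carrier R"
    and x0: "x0 \<in> I" "x0 \<noteq> \<zero>" and y0: "y0 \<in> J" "y0 \<noteq> \<zero>"
    and d: "d \<in> carrier R" "d \<noteq> \<zero>" "\<And>w r. w \<in> almost_integral J r \<Longrightarrow> d \<otimes> w \<in> ipow J r"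
  shows "\<exists>p q. q \<ge> 1 \<and> (\<forall>n r. ipow I n \<subseteq> almost_integral J r \<longrightarrow> r * q \<le> p * n) \<and>
     (\<forall>n. ipow I (q * n) \<subseteq> almost_integral J (p * n))"
proof -
  note carrI = ideal_facts(2)[OF ideal_ipow[OF I]]
  have x0c: "x0 \<in> carrier R" and y0c: "y0 \<in> carrier R"
    using ideal_facts(2)[OF I x0(1)] ideal_facts(2)[OF J(1) y0(1)] by auto
  have "\<exists>m. \<forall>r. ipow I n \<subseteq> almost_integral J r \<longleftrightarrow> r \<le> m" for n
  proof -
    define P where "P r \<longleftrightarrow> ipow I n \<subseteq> almost_integral J r" for r
    have down: "P s \<Longrightarrow> r \<le> s \<Longrightarrow> P r" for r s
      using almost_integral_antimono[OF J(1), of r s] unfolding P_def by blast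
    have "P 0"
      using carrI ipow_subset_almost_integral[OF J(1), of 0] unfolding P_def by auto
    \<comment> \<open>Otherwise the nonzero element \<open>d * x0 ^ n\<close> would lie in every
      power of the proper ideal \<open>J\<close>.\<close>
    have "\<exists>r. \<not> P r"
    proof (rule ccontr)
      assume "\<not> ?thesis"
      then have all: "ipow I n \<subseteq> almost_integral J r" for r unfolding P_def by blast
      have "x0 [^] n \<in> ipow I n" using pow_mem_ipow[OF I, of x0 1 n] x0 ipow_1[OF I] by simp
      then have "d \<otimes> x0 [^] n \<in> ipow J r" for r using all d(3) by blast
      moreover have "d \<otimes> x0 [^] n \<noteq> \<zero>"
      proof -
        have "x0 [^] n \<noteq> \<zero>" by (induction n) (use x0 x0c integral_iff in auto)
        then show ?thesis using d x0c integral_iff by simp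
      qed
      ultimately show False using krull_intersection[OF J(1)] J(2) by blast
    qed
    define N where "N = (LEAST r. \<not> P r)"
    have N: "\<not> P N" "r < N \<Longrightarrow> P r" for r
      using LeastI_ex[OF \<open>\<exists>r. \<not> P r\<close>] not_less_Least unfolding N_def by blast+
    have "N > 0" using N(1) \<open>P 0\<close> by (cases N) auto
    then have "P r \<longleftrightarrow> r \<le> N - 1" for r
      using N down[of r N] by (cases "r < N") (auto intro: down)
    then show ?thesis unfolding P_def by blast
  qed
  then obtain v where v: "\<And>n r. ipow I n \<subseteq> almost_integral J r \<longleftrightarrow> r \<le> v n" by metis
  have v_mem: "x \<in> almost_integral J (v n)" if "x \<in> ipow I n" for x n using v[of n "v n"] that by auto
  have prod_le: "r \<le> v (m + n)"
    if prods: "\<And>x y. x \<in> ipow I m \<Longrightarrow> y \<in> ipow I n \<Longrightarrow> x \<otimes> y \<in> almost_integral J r" for m n r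
  proof -
    have "ipow I (m + n) \<subseteq> almost_integral J r"
    proof
      fix z assume "z \<in> ipow I (m + n)"
      then have "z \<in> ipow I m \<cdot> ipow I n" by (simp add: ipow_add[OF I])
      then show "z \<in> almost_integral J r"
        by induction (use prods almost_integral_add[OF J(1)] in auto)
    qed
    then show ?thesis using v by blast
  qed
  have super: "v m + v n \<le> v (m + n)" for m n
    by (rule prod_le) (use v_mem almost_integral_mult[OF J(1)] in blast)
  \<comment> \<open>The factor \<open>d\<close> moves \<open>y\<close> from the integral closure of
    \<open>J ^ v m\<close> into \<open>J ^ v m\<close>, where the Rees algebra of \<open>J\<close>
    is known to be Noetherian. The set does not depend on \<open>n\<close>, so neither do the
    finitely many witnesses obtained from it.\<close>
  define T where "T = {(v m, d \<otimes> y) | m y. m \<ge> 1 \<and> y \<in> ipow I m}"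
  have "T \<subseteq> homogeneous (ipow J)" using d(3) v_mem by (auto simp: T_def homogeneous_def)
  then obtain F where F: "F \<subseteq> T" "finite F" "T \<subseteq> hspan R (ipow J) F"
    using graded_noetherian_ipow[OF J(1), unfolded graded_noetherian_def, rule_format, of T] by metis
  have "\<forall>f\<in>F. \<exists>m y. m \<ge> 1 \<and> f = (v m, d \<otimes> y) \<and> y \<in> ipow I m"
    using F(1) unfolding T_def by blast
  then obtain \<mu> \<eta> where F_eq: "\<And>f. f \<in> F \<Longrightarrow> \<mu> f \<ge> (1::nat)"
    "\<And>f. f \<in> F \<Longrightarrow> f = (v (\<mu> f), d \<otimes> \<eta> f)" "\<And>f. f \<in> F \<Longrightarrow> \<eta> f \<in> ipow I (\<mu> f)"
    by metis
  have "\<exists>j\<in>\<mu> ` F. v (n + j) = v n + v j" if n: "n \<ge> 1" for n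
  proof (rule ccontr)
    assume "\<not> ?thesis"
    then have jump: "v n + v j + 1 \<le> v (n + j)" if "j \<in> \<mu> ` F" for j
      using super[of n j] that by (metis Suc_eq_plus1 Suc_leI le_neq_implies_less)
    \<comment> \<open>Multiplication by \<open>x\<close> raises the order of each generator in
      \<open>F\<close> by at least \<open>v n + 1\<close>, hence also that of every combination.
      This spreads the strict inequality from the finitely many witnesses to all
      \<open>m \<ge> 1\<close>.\<close>
    have lift: "\<exists>w \<in> almost_integral J (e + (v n + 1)). x \<otimes> f = d \<otimes> w"
      if x: "x \<in> ipow I n" and "(e, f) \<in> hspan R (ipow J) F" for x e f
      using that(2)
    proof induction
      case (zero e)
      have "\<zero> \<in> almost_integral J (e + (v n + 1))"
        using ideal_facts(1)[OF ideal_ipow[OF J(1)]] ipow_subset_almost_integral[OF J(1)] by blast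
      then show ?case using carrI[OF x] d by (intro bexI[of _ \<zero>]) auto
    next
      case (gen e f r k)
      define j y where "j = \<mu> (e, f)" and "y = \<eta> (e, f)"
      have j: "j \<in> \<mu> ` F" "e = v j" "f = d \<otimes> y" "y \<in> ipow I j"
        using F_eq(2,3)[OF gen(1)] gen(1) by (auto simp: j_def y_def)
      have "x \<otimes> y \<in> ipow I (n + j)" by (rule ipow_mult_mem[OF I x j(4)])
      then have "x \<otimes> y \<in> almost_integral J (v j + (v n + 1))"
        using v_mem almost_integral_antimono[OF J(1) jump[OF j(1)]] by (auto simp: ac_simps)
      then have "r \<otimes> (x \<otimes> y) \<in> almost_integral J (k + (v j + (v n + 1)))"
        using gen(2) ipow_subset_almost_integral[OF J(1)] almost_integral_mult[OF J(1)] by blast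
      moreover have "x \<otimes> (r \<otimes> f) = d \<otimes> (r \<otimes> (x \<otimes> y))"
        using carrI[OF x] carrI[OF j(4)] ideal_facts(2)[OF ideal_ipow[OF J(1)] gen(2)] d
        unfolding j(3) by (simp add: m_ac)
      ultimately show ?case using j(2) by (auto simp: add.assoc)
    next
      case (add e f f')
      obtain w w' where w: "w \<in> almost_integral J (e + (v n + 1))" "x \<otimes> f = d \<otimes> w"
        "w' \<in> almost_integral J (e + (v n + 1))" "x \<otimes> f' = d \<otimes> w'" using add.IH by blast
      have "F \<subseteq> homogeneous (ipow J)" using F(1) \<open>T \<subseteq> homogeneous (ipow J)\<close> by (rule subset_trans)
      from hspan_homogeneous[OF graded_family_ipow[OF J(1)] this]
      have "f \<in> carrier R" "f' \<in> carrier R"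
        using add.hyps ideal_facts(2)[OF ideal_ipow[OF J(1)]] by (auto simp: homogeneous_def)
      then have "x \<otimes> (f \<oplus> f') = d \<otimes> (w \<oplus> w')"
        using w d carrI[OF x] almost_integralD(1) by (simp add: r_distr)
      then show ?case using almost_integral_add[OF J(1) w(1,3)] by blast
    qed
    have jump_all: "v m + (v n + 1) \<le> v (n + m)" if m: "m \<ge> 1" for m
    proof (rule prod_le)
      fix x y assume x: "x \<in> ipow I n" and y: "y \<in> ipow I m"
      have "(v m, d \<otimes> y) \<in> hspan R (ipow J) F" using F(3) m y unfolding T_def by blast
      then obtain w where w: "w \<in> almost_integral J (v m + (v n + 1))" "x \<otimes> (d \<otimes> y) = d \<otimes> w"
        using lift[OF x] by blast
      have "d \<otimes> (x \<otimes> y) = d \<otimes> w" using w(2) carrI[OF x] carrI[OF y] d by (simp add: m_lcomm)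
      then have "x \<otimes> y = w"
        using m_lcancel[of d "x \<otimes> y" w] d carrI[OF x] carrI[OF y] almost_integralD(1)[OF w(1)] by simp
      then show "x \<otimes> y \<in> almost_integral J (v m + (v n + 1))" using w(1) by simp
    qed
    \<comment> \<open>Only the first of the \<open>k\<close> summands, \<open>v n\<close> itself,
      falls short of \<open>v n + 1\<close>; hence the deficit of one.\<close>
    have growth: "(v n + 1) * k \<le> v (n * k) + 1" for k
    proof (induction k)
      case (Suc k)
      show ?case
      proof (cases "k = 0")
        case False
        then have "v (n * k) + (v n + 1) \<le> v (n + n * k)" using n by (intro jump_all) simp
        then show ?thesis using Suc by simp
      qed simp
    qed simp
    have "ipow I n \<subseteq> almost_integral J (v n + 1)"
    proof
      fix x assume x: "x \<in> ipow I n"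
      \<comment> \<open>In the multiplier, \<open>d\<close> passes from integral closures to true
        powers of \<open>J\<close>, and \<open>y0\<close> supplies the one missing power.\<close>
      show "x \<in> almost_integral J (v n + 1)"
      proof (rule almost_integralI[of _ "y0 \<otimes> d"])
        fix k :: nat
        have "x [^] k \<in> almost_integral J (v (n * k))" by (rule v_mem[OF pow_mem_ipow[OF I x]])
        then have "d \<otimes> x [^] k \<in> ipow J (v (n * k))" by (rule d(3))
        moreover have "y0 \<in> ipow J 1" using y0 ipow_1[OF J(1)] by simp
        ultimately have "y0 \<otimes> (d \<otimes> x [^] k) \<in> ipow J (1 + v (n * k))"
          by (intro ipow_mult_mem[OF J(1)])
        then have "y0 \<otimes> (d \<otimes> x [^] k) \<in> ipow J ((v n + 1) * k)"
          using ipow_antimono[OF J(1) growth[of k]] by auto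
        then show "(y0 \<otimes> d) \<otimes> x [^] k \<in> ipow J ((v n + 1) * k)"
          using y0c d carrI[OF x] by (simp add: m_assoc)
      qed (use carrI[OF x] y0 y0c d integral_iff in auto)
    qed
    then show False using v[of n "v n + 1"] by simp
  qed
  moreover have "0 \<notin> \<mu> ` F" using F_eq(1) by force
  ultimately obtain q where q: "q \<ge> 1" "\<And>n. v n * q \<le> v q * n"
    using superadditive_slope_attained[OF super, of "\<mu> ` F"] F(2) by blast
  have mult: "v q * n \<le> v (q * n)" for n
  proof (induction n)
    case (Suc n)
    then show ?case using super[of q "q * n"] by simp
  qed simp
  show ?thesis
  proof (intro exI conjI allI impI)
    fix n r assume "ipow I n \<subseteq> almost_integral J r"
    then have "r * q \<le> v n * q" using v by simp
    then show "r * q \<le> v q * n" using q(2)[of n] by linarith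
  qed (use q(1) mult v in auto)
qed

end

section \<open>The resurgence number\<close>

text \<open>The ratio \<open>s / r\<close> is the limit of \<open>s m / (r m + 1)\<close>. These
  slightly smaller ratios leave room for bounded errors.\<close>

lemma ereal_ratio_le:
  assumes "r \<ge> (1::nat)"
    and le: "\<And>m::nat. m \<ge> 1 \<Longrightarrow> ereal (real (s * m) / real (r * m + 1)) \<le> C"
  shows "ereal (real s / real r) \<le> C"
proof -
  have "(\<lambda>m. real s / (real r + 1 / real m)) \<longlonglongrightarrow> real s / (real r + 0)"
    by (intro tendsto_intros lim_1_over_n) (use assms(1) in simp)
  then have "(\<lambda>m. ereal (real s / (real r + 1 / real m))) \<longlonglongrightarrow> ereal (real s / real r)"
    by simp
  moreover have "ereal (real s / (real r + 1 / real m)) \<le> C" if "m \<ge> 1" for m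
  proof -
    have "real s / (real r + 1 / real m) = real (s * m) / real (r * m + 1)"
      using that by (simp add: field_simps)
    then show ?thesis using le[OF that] by simp
  qed
  ultimately show ?thesis using Lim_bounded by blast
qed

context noetherian_domain
begin

text \<open>Larger ideals have fewer non-containments, which gives one inequality. For the other,
  passing from \<open>(s, r)\<close> to \<open>(s m, r m + 1)\<close> adds \<open>t\<close> to the
  index of \<open>b\<close>, which absorbs the shift \<open>D\<close> as soon as
  \<open>t \<ge> D\<close>.\<close>

lemma resurgence_eq_integral_closure:
  assumes a: "ideal_filtration R a" and b: "ideal_filtration R b"
    and D: "\<And>n. n \<ge> D \<Longrightarrow> integral_closure R (b n) \<subseteq> b (n - D)"
  shows "asymptotic_resurgence a b = asymptotic_resurgence a (\<lambda>i. integral_closure R (b i))"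
proof (rule antisym)
  let ?C = "asymptotic_resurgence a (\<lambda>i. integral_closure R (b i))"
  have sub: "b n \<subseteq> integral_closure R (b n)" for n
    by (rule subset_integral_closure[OF ideal_filtrationD(2)[OF b]])
  have "\<forall>\<^sub>F t in sequentially. \<not> a (s * t) \<subseteq> b (r * t)"
    if "\<forall>\<^sub>F t in sequentially. \<not> a (s * t) \<subseteq> integral_closure R (b (r * t))" for s r
    using that by (rule eventually_mono) (use sub in blast)
  then show "?C \<le> asymptotic_resurgence a b"
    unfolding asymptotic_resurgence_def by (intro Sup_subset_mono) blast
  show "asymptotic_resurgence a b \<le> ?C"
    unfolding asymptotic_resurgence_def[of a b]
  proof (rule Sup_least)
    fix x assume "x \<in> {ereal (real s / real r) |s r. 1 \<le> s \<and> 1 \<le> r \<and>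
      (\<forall>\<^sub>F t in sequentially. \<not> a (s * t) \<subseteq> b (r * t))}"
    then obtain s r where x: "x = ereal (real s / real r)" "s \<ge> 1" "r \<ge> 1"
      and ev: "\<forall>\<^sub>F t in sequentially. \<not> a (s * t) \<subseteq> b (r * t)" by blast
    obtain T where T: "\<And>t. t \<ge> T \<Longrightarrow> \<not> a (s * t) \<subseteq> b (r * t)"
      using ev unfolding eventually_sequentially by blast
    have "ereal (real (s * m) / real (r * m + 1)) \<le> ?C" if m: "m \<ge> 1" for m
    proof -
      have "\<not> a (s * m * t) \<subseteq> integral_closure R (b ((r * m + 1) * t))" if t: "t \<ge> max T D" for t
      proof -
        have "integral_closure R (b ((r * m + 1) * t)) \<subseteq> b ((r * m + 1) * t - D)"
          using t by (intro D) simp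
        also have "\<dots> \<subseteq> b (r * (m * t))"
        proof (rule ideal_filtrationD(3)[OF b])
          have "r * (m * t) + D \<le> (r * m + 1) * t" using t by (simp add: algebra_simps)
          then show "r * (m * t) \<le> (r * m + 1) * t - D" by linarith
        qed
        finally have "integral_closure R (b ((r * m + 1) * t)) \<subseteq> b (r * (m * t))" .
        moreover have "T \<le> m * t"
        proof -
          have "1 * t \<le> m * t" using m by (rule mult_le_mono1)
          then show ?thesis using t by linarith
        qed
        ultimately show ?thesis using T[of "m * t"] by (auto simp: mult.assoc)
      qed
      then have "\<forall>\<^sub>F t in sequentially. \<not> a (s * m * t) \<subseteq> integral_closure R (b ((r * m + 1) * t))"
        unfolding eventually_sequentially by blast
      moreover have "1 \<le> s * m" "1 \<le> r * m + 1" using x(2) m by simp_all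
      ultimately show ?thesis
        unfolding asymptotic_resurgence_def by (intro Sup_upper) blast
    qed
    then show "x \<le> ?C" unfolding x(1) using x(3) by (rule ereal_ratio_le[rotated])
  qed
qed

text \<open>Ratios \<open>s / r\<close> strictly below \<open>k q / (p l)\<close> always occur in
  the supremum and ratios strictly above it never do; for \<open>p = 0\<close> the threshold is
  infinite.\<close>

lemma resurgence_eq_slope:
  assumes a: "ideal_filtration R a" and b: "ideal_filtration R b"
    and k: "k \<ge> 1" and l: "l \<ge> 1"
    and aI: "\<And>n. a (k * n) = ipow (a k) n" and bJ: "\<And>n. b (l * n) = ipow (b l) n"
    and D: "\<And>n. n \<ge> D \<Longrightarrow> integral_closure R (b n) \<subseteq> b (n - D)"
    and q: "q \<ge> 1"
    and upper: "\<And>n r. ipow (a k) n \<subseteq> almost_integral (b l) r \<Longrightarrow> r * q \<le> p * n"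
    and lower: "\<And>n. ipow (a k) (q * n) \<subseteq> almost_integral (b l) (p * n)"
  shows "asymptotic_resurgence a b =
    (if p = 0 then \<infinity> else ereal (real (k * q) / real (p * l)))"
proof -
  have bl: "ideal (b l) R" by (rule ideal_filtrationD(2)[OF b])
  have above: "\<forall>\<^sub>F t in sequentially. \<not> a (s * t) \<subseteq> b (r * t)"
    if lt: "s * p * l + 1 \<le> r * k * q" for s r
    unfolding eventually_sequentially
  proof (intro exI allI impI notI)
    fix t assume t: "k * l * (p + q) + 1 \<le> t" and sub: "a (s * t) \<subseteq> b (r * t)"
    \<comment> \<open>The index \<open>s t\<close> is rounded up to a multiple of \<open>k\<close>
      and \<open>r t\<close> down to a multiple of \<open>l\<close>. The total rounding error is at
      most \<open>k * l * (p + q)\<close>, which the bound on \<open>t\<close> exceeds.\<close>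
    define n m where "n = s * t div k + 1" and "m = r * t div l"
    have n: "s * t \<le> k * n" "k * n \<le> s * t + k"
      unfolding n_def using k by (simp_all add: dividend_less_times_div less_imp_le algebra_simps)
    have m: "l * m \<le> r * t" "r * t \<le> l * (m + 1)"
      unfolding m_def using l by (simp_all add: dividend_less_times_div less_imp_le algebra_simps)
    have "ipow (a k) n \<subseteq> a (s * t)"
      using ideal_filtrationD(3)[OF a n(1)] by (simp add: aI)
    also note sub
    also have "b (r * t) \<subseteq> ipow (b l) m"
      using ideal_filtrationD(3)[OF b m(1)] by (simp add: bJ)
    also have "\<dots> \<subseteq> almost_integral (b l) m" by (rule ipow_subset_almost_integral[OF bl])
    finally have mq: "m * q \<le> p * n" by (rule upper)
    have "t * (s * p * l + 1) \<le> t * (r * k * q)" using lt by (rule mult_le_mono2)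
    also have "\<dots> = (r * t) * (k * q)" by simp
    also have "\<dots> \<le> l * (m + 1) * (k * q)" using m(2) by (rule mult_le_mono1)
    also have "\<dots> = k * l * (m * q) + k * l * q" by (simp add: algebra_simps)
    also have "\<dots> \<le> k * l * (p * n) + k * l * q" using mq by simp
    also have "\<dots> = l * p * (k * n) + k * l * q" by (simp add: algebra_simps)
    also have "\<dots> \<le> l * p * (s * t + k) + k * l * q" using n(2) by simp
    also have "\<dots> = t * (s * p * l) + k * l * (p + q)" by (simp add: algebra_simps)
    finally show False using t by simp
  qed
  have below: "\<not> (\<forall>\<^sub>F t in sequentially. \<not> a (s * t) \<subseteq> b (r * t))"
    if lt: "r * k * q + 1 \<le> s * p * l" for s r
  proof
    assume "\<forall>\<^sub>F t in sequentially. \<not> a (s * t) \<subseteq> b (r * t)"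
    then obtain T where T: "\<And>t. t \<ge> T \<Longrightarrow> \<not> a (s * t) \<subseteq> b (r * t)"
      unfolding eventually_sequentially by blast
    \<comment> \<open>The containment is tested at \<open>t = k * q * \<tau>\<close>, where
      \<open>a (s * t)\<close> is a power of \<open>a k\<close> with exponent divisible by
      \<open>q\<close>. The strict inequality leaves a gap of at least \<open>\<tau>\<close>, enough
      for the shift \<open>D\<close>.\<close>
    define \<tau> where "\<tau> = T + D"
    have "(r * k * q + 1) * \<tau> \<le> (s * p * l) * \<tau>" using lt by (rule mult_le_mono1)
    then have "r * (k * q * \<tau>) + \<tau> \<le> l * (p * (s * \<tau>))" by (simp add: algebra_simps)
    then have bound: "r * (k * q * \<tau>) + D \<le> l * (p * (s * \<tau>))" by (simp add: \<tau>_def)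
    have "a (s * (k * q * \<tau>)) = ipow (a k) (q * (s * \<tau>))"
      by (simp add: aI[symmetric] ac_simps)
    also have "\<dots> \<subseteq> almost_integral (b l) (p * (s * \<tau>))" by (rule lower)
    also have "\<dots> \<subseteq> integral_closure R (b (l * (p * (s * \<tau>))))"
      using almost_integral_imp_integral_closure[OF bl] by (auto simp: bJ)
    also have "\<dots> \<subseteq> b (l * (p * (s * \<tau>)) - D)" using bound by (intro D) simp
    also have "\<dots> \<subseteq> b (r * (k * q * \<tau>))" using bound by (intro ideal_filtrationD(3)[OF b]) simp
    finally have "a (s * (k * q * \<tau>)) \<subseteq> b (r * (k * q * \<tau>))" .
    moreover have "T \<le> k * q * \<tau>"
    proof -
      have "1 * \<tau> \<le> k * q * \<tau>" using k q by (intro mult_le_mono1) simp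
      moreover have "T \<le> \<tau>" by (simp add: \<tau>_def)
      ultimately show ?thesis by linarith
    qed
    ultimately show False using T by blast
  qed
  show ?thesis
  proof (cases "p = 0")
    case True
    have "asymptotic_resurgence a b = \<infinity>"
    proof (rule ereal_top)
      fix B :: real
      obtain N :: nat where N: "B \<le> real N" using real_arch_simple by blast
      have "ereal (real (N + 1) / real (1::nat)) \<le> asymptotic_resurgence a b"
        unfolding asymptotic_resurgence_def
      proof (rule Sup_upper, intro CollectI exI conjI)
        show "\<forall>\<^sub>F t in sequentially. \<not> a ((N + 1) * t) \<subseteq> b (1 * t)"
          using k q True by (intro above) simp
      qed auto
      then show "ereal B \<le> asymptotic_resurgence a b"
        using N by (metis ereal_less_eq(3) add_increasing2 div_by_1 dual_order.trans of_nat_1 of_nat_add zero_le_one)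
    qed
    then show ?thesis using True by simp
  next
    case False
    have "asymptotic_resurgence a b \<le> ereal (real (k * q) / real (p * l))"
      unfolding asymptotic_resurgence_def
    proof (rule Sup_least)
      fix x assume "x \<in> {ereal (real s / real r) |s r. 1 \<le> s \<and> 1 \<le> r \<and>
        (\<forall>\<^sub>F t in sequentially. \<not> a (s * t) \<subseteq> b (r * t))}"
      then obtain s r where x: "x = ereal (real s / real r)" "r \<ge> 1"
        and ev: "\<forall>\<^sub>F t in sequentially. \<not> a (s * t) \<subseteq> b (r * t)" by blast
      have "\<not> r * k * q + 1 \<le> s * p * l" using below[of r s] ev by blast
      then have "s * (p * l) \<le> (k * q) * r" by (simp add: not_less_eq_eq ac_simps)
      then have "real (s * (p * l)) \<le> real (k * q * r)" by (simp only: of_nat_le_iff)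
      then show "x \<le> ereal (real (k * q) / real (p * l))"
        unfolding x(1) using x(2) False l by (simp add: frac_le_eq divide_simps)
    qed
    \<comment> \<open>The ratios \<open>k q m / (p l m + 1)\<close> lie strictly below the threshold
      and converge to it.\<close>
    moreover have "ereal (real (k * q) / real (p * l)) \<le> asymptotic_resurgence a b"
    proof (rule ereal_ratio_le)
      fix m :: nat assume m: "m \<ge> 1"
      show "ereal (real (k * q * m) / real (p * l * m + 1)) \<le> asymptotic_resurgence a b"
        unfolding asymptotic_resurgence_def
      proof (rule Sup_upper, intro CollectI exI conjI)
        show "\<forall>\<^sub>F t in sequentially. \<not> a (k * q * m * t) \<subseteq> b ((p * l * m + 1) * t)"
          using k q by (intro above) (simp add: algebra_simps)
      qed (use k q m in auto)
    qed (use False l in simp)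
    ultimately show ?thesis using False by simp
  qed
qed

end

theorem corollary3p11:
  fixes S :: "('a, 'm) ring_scheme"
    and a b :: "nat \<Rightarrow> 'a set"
    and k l :: nat
  assumes "noetherian_domain S"
    and "ideal_filtration S a"
    and "ideal_filtration S b"
    and "\<And>i. i \<ge> 1 \<Longrightarrow> a i \<noteq> {\<zero>\<^bsub>S\<^esub>}"
    and "\<And>i. i \<ge> 1 \<Longrightarrow> b i \<noteq> {\<zero>\<^bsub>S\<^esub>}"
    and "k \<ge> 1"
    and "l \<ge> 1"
    and "veronese_standard_graded S k a"
    and "veronese_standard_graded S l b"
    and "finitely_generated_over (UP S) (rees_algebra S b)
           (rees_algebra S (\<lambda>i. integral_closure S (b i)))"
  shows "asymptotic_resurgence a b = asymptotic_resurgence a (\<lambda>i. integral_closure S (b i)) \<and>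
         (asymptotic_resurgence a b = \<infinity> \<or> asymptotic_resurgence a b = - \<infinity> \<or>
          (\<exists>q::rat. asymptotic_resurgence a b = ereal (of_rat q)))"
proof -
  interpret noetherian_domain S by fact
  have bl: "ideal (b l) S" and ak: "ideal (a k) S"
    using ideal_filtrationD(2) assms(2,3) by auto
  have aI: "a (k * n) = ipow (a k) n" for n
    by (rule veronese_standard_gradedD[OF assms(2,6,8)])
  have bJ: "b (l * n) = ipow (b l) n" for n
    by (rule veronese_standard_gradedD[OF assms(3,7,9)])
  have "integral_closure S (b n) \<subseteq> carrier S" "\<zero>\<^bsub>S\<^esub> \<in> integral_closure S (b n)" for n
    using ideal_facts(1)[OF ideal_filtrationD(2)[OF assms(3)], of n]
      subset_integral_closure[OF ideal_filtrationD(2)[OF assms(3)], of n]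
    by (auto simp: integral_closure_def)
  then obtain D0 where D0: "\<And>n. n \<ge> D0 \<Longrightarrow> integral_closure S (b n) \<subseteq> b (n - D0)"
    using finitely_generated_rees_shift[OF assms(3) _ _ assms(10)] by blast
  \<comment> \<open>A positive \<open>D\<close> places \<open>b D\<close> among the ideals assumed
    nonzero, from which the multiplier \<open>d\<close> is taken.\<close>
  define D where "D = Suc D0"
  have D: "integral_closure S (b n) \<subseteq> b (n - D)" if "n \<ge> D" for n
  proof -
    have "integral_closure S (b n) \<subseteq> b (n - D0)" using that by (intro D0) (simp add: D_def)
    also have "\<dots> \<subseteq> b (n - D)" by (intro ideal_filtrationD(3)[OF assms(3)]) (simp add: D_def)
    finally show ?thesis .
  qed
  have eq: "asymptotic_resurgence a b = asymptotic_resurgence a (\<lambda>i. integral_closure S (b i))"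
    by (rule resurgence_eq_integral_closure[OF assms(2,3) D])
  have nonzero: "\<exists>x\<in>f n. x \<noteq> \<zero>\<^bsub>S\<^esub>"
    if "ideal_filtration S f" "f n \<noteq> {\<zero>\<^bsub>S\<^esub>}" for f :: "nat \<Rightarrow> 'a set" and n
    using that ideal_facts(1)[OF ideal_filtrationD(2)[OF that(1)], of n] by blast
  show ?thesis
  proof (cases "b l = carrier S")
    \<comment> \<open>Every \<open>b n\<close> contains some \<open>b (l * n)\<close> and so is the
      whole ring: no ratio qualifies, and the supremum is that of the empty set.\<close>
    case True
    have "ipow (carrier S) n = carrier S" for n
      by (induction n) (simp_all add: ideal_prod_one oneideal)
    then have full: "carrier S \<subseteq> b n" for n
      using ideal_filtrationD(3)[OF assms(3), of n "l * n"] assms(7) True by (simp add: bJ)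
    have "a m \<subseteq> b n" for m n
      using full ideal_facts(2)[OF ideal_filtrationD(2)[OF assms(2)]] by blast
    then have "asymptotic_resurgence a b = - \<infinity>"
      by (simp add: asymptotic_resurgence_def bot_ereal_def)
    then show ?thesis using eq by simp
  next
    case False
    obtain d where d: "d \<in> b D" "d \<noteq> \<zero>\<^bsub>S\<^esub>"
      using nonzero[OF assms(3) assms(5)[of D]] by (auto simp: D_def)
    have dc: "d \<in> carrier S" using ideal_facts(2)[OF ideal_filtrationD(2)[OF assms(3)] d(1)] .
    obtain x0 where x0: "x0 \<in> a k" "x0 \<noteq> \<zero>\<^bsub>S\<^esub>"
      using nonzero[OF assms(2) assms(4)[OF assms(6)]] by blast
    obtain y0 where y0: "y0 \<in> b l" "y0 \<noteq> \<zero>\<^bsub>S\<^esub>"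
      using nonzero[OF assms(3) assms(5)[OF assms(7)]] by blast
    obtain p q where q: "q \<ge> 1"
      and upper: "\<And>n r. ipow (a k) n \<subseteq> almost_integral (b l) r \<Longrightarrow> r * q \<le> p * n"
      and lower: "\<And>n. ipow (a k) (q * n) \<subseteq> almost_integral (b l) (p * n)"
      using order_slope_exists[OF ak bl False x0 y0 dc d(2)
          almost_integral_conductor[OF assms(3) bJ D d(1)]] by blast
    have "asymptotic_resurgence a b = (if p = 0 then \<infinity> else ereal (real (k * q) / real (p * l)))"
      by (rule resurgence_eq_slope[OF assms(2,3,6,7) aI bJ D q upper lower])
    moreover have "real (k * q) / real (p * l) = of_rat (of_nat (k * q) / of_nat (p * l))"
      by (simp add: of_rat_divide of_rat_mult)
    ultimately have "asymptotic_resurgence a b = \<infinity> \<or>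
        (\<exists>q::rat. asymptotic_resurgence a b = ereal (of_rat q))"
      by (cases "p = 0") auto
    then show ?thesis using eq by blast
  qed
qed

end
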